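(* There exist a symbolic space $X=\mathcal A^{\mathbb N}$ ($\mathcal A$ a finite alphabet) and a computable map $T:X\to X$ with a $\Pi_2$-complete $T$-invariant subset $A\subset X$ which is the unique attractor of $T$ in both the topological and the metric sense. The reference measure for the latter can be taken to be any shift-ergodic measure of full support on $X$.
   Context: **Symbolic space.** On $X=\mathcal A^{\mathbb N}$, $\mathcal A$ a finite alphabet, the distance is $d(x,y)=2^{-\min\{n:x_n\ne y_n\}}$; the ideal points are the eventually constant sequences $w0^\infty$, $w\in\mathcal A^*$ (with $0\in\mathcal A$ a fixed letter). The ideal balls are the open balls with ideal center and positive rational radius (they are cylinders); $(B_i)_{i\in\mathbb N}$ is a fixed computable enumeration of them, and $\overline{B_i}$ is the closed ball with the same center and radius. A map $T:X\to X$ is computable iff there are a non-decreasing computable function $\varphi:\mathbb N\to\mathbb N$ and an algorithm which, given the first $\varphi(n)$ symbols of $x$, computes the first $n$ symbols of $T(x)$. The shift is $\sigma(x)_i=x_{i+1}$. A measure is shift-ergodic if it is a $\sigma$-invariant and $\sigma$-ergodic Borel probability measure. **Complexity of closed sets.** A compact set $K$ is $\Pi_n$ if its outer collection $\{i:\overline{B_i}\cap K=\emptyset\}$ is a $\Sigma_n$ set of integers (arithmetical hierarchy). $K$ is $\Pi_n$-complete if it is $\Pi_n$ and any other $\Pi_n$ compact set $K'$ can be reduced to $K$, in the sense that, provided with an enumeration of the outer collection of $K$, we can (algorithmically) enumerate the outer collection of $K'$. **Attractors.** $\omega(x)$ is the set of accumulation points of $x,T(x),T^2(x),\dots$. For a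 closed set $A$, $\rho(A)=\{x:\omega(x)\subset A\}$. A set is generic if it contains a countable intersection of open dense sets; meager sets are complements of generic sets. A closed set $A$ is a metric attractor (with respect to a reference measure $\lambda$) if $\rho(A)$ has full $\lambda$-measure and no strictly smaller closed $A'\subset A$ has $\lambda(\rho(A'))>0$. It is a topological attractor if $\rho(A)$ is generic and no strictly smaller closed $A'\subset A$ has $\rho(A')$ non-meager. *)

theory Defs
  imports "HOL-Analysis.Analysis" "HOL-Library.Nat_Bijection"
begin

text \<open>Partial recursive functions, given by programs and a big-step semantics:
  \<open>computes p xs y\<close> says that \<open>p\<close> halts on the arguments \<open>xs\<close> with the result \<open>y\<close>.\<close>

datatype prog =
    Zero
  | Succ
  | Proj nat
  | Comp prog "prog list"
  | PrimRec prog prog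
  | Minim prog

inductive computes :: "prog \<Rightarrow> nat list \<Rightarrow> nat \<Rightarrow> bool" where
  computes_Zero: "computes Zero xs 0"
| computes_Succ: "computes Succ (x # xs) (Suc x)"
| computes_Proj: "i < length xs \<Longrightarrow> computes (Proj i) xs (xs ! i)"
| computes_Comp: "list_all2 (\<lambda>g y. computes g xs y) gs ys \<Longrightarrow> computes f ys z
    \<Longrightarrow> computes (Comp f gs) xs z"
| computes_PrimRec_0: "computes f xs y \<Longrightarrow> computes (PrimRec f g) (0 # xs) y"
| computes_PrimRec_Suc: "computes (PrimRec f g) (n # xs) r \<Longrightarrow> computes g (n # r # xs) y
    \<Longrightarrow> computes (PrimRec f g) (Suc n # xs) y"
| computes_Minim: "computes f (n # xs) 0 \<Longrightarrow> (\<forall>m<n. \<exists>y. computes f (m # xs) (Suc y))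
    \<Longrightarrow> computes (Minim f) xs n"

lemma computes_deterministic:
  "computes p xs y \<Longrightarrow> computes p xs z \<Longrightarrow> y = z"
proof (induction p xs y arbitrary: z rule: computes.induct)
  case (computes_Zero xs)
  then show ?case by (auto elim: computes.cases)
next
  case (computes_Succ x xs)
  then show ?case by (auto elim: computes.cases)
next
  case (computes_Proj i xs)
  then show ?case by (auto elim: computes.cases)
next
  case (computes_Comp xs gs ys f z')
  from computes_Comp.prems obtain ys' where
    ys': "list_all2 (\<lambda>g y. computes g xs y) gs ys'" "computes f ys' z"
    by (cases rule: computes.cases) auto
  have "ys = ys'"
    using computes_Comp.IH(1) ys'(1) by (auto simp: list_all2_conv_all_nth intro!: nth_equalityI)
  with ys'(2) computes_Comp.IH(2) show ?case by blast
next
  case (computes_PrimRec_0 f xs y g)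
  from computes_PrimRec_0.prems have "computes f xs z"
    by (cases rule: computes.cases) auto
  with computes_PrimRec_0.IH show ?case by blast
next
  case (computes_PrimRec_Suc f g n xs r y)
  from computes_PrimRec_Suc.prems obtain r' where
    "computes (PrimRec f g) (n # xs) r'" "computes g (n # r' # xs) z"
    by (cases rule: computes.cases) auto
  with computes_PrimRec_Suc.IH show ?case by blast
next
  case (computes_Minim f n xs)
  from computes_Minim.prems have z: "computes f (z # xs) 0"
    "\<forall>m<z. \<exists>y. computes f (m # xs) (Suc y)"
    by (cases rule: computes.cases, auto)+
  have "\<not> z < n" using computes_Minim.IH(2) z(1) by fastforce
  moreover have "\<not> n < z" using computes_Minim.IH(1) z(2) by fastforce
  ultimately show ?case by simp
qed

definition computable_fun :: "(nat \<Rightarrow> nat) \<Rightarrow> bool" where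
  "computable_fun f \<longleftrightarrow> (\<exists>p. \<forall>n. computes p [n] (f n))"

definition decidable_set :: "nat set \<Rightarrow> bool" where
  "decidable_set S \<longleftrightarrow> computable_fun (\<lambda>n. of_bool (n \<in> S))"

text \<open>The class \<open>\<Sigma>\<^sub>n\<close> of the arithmetical hierarchy; \<open>P\<close> belongs to \<open>\<Pi>\<^sub>n\<close> iff \<open>- P\<close> belongs
  to \<open>\<Sigma>\<^sub>n\<close>.\<close>

primrec Sigma_set :: "nat \<Rightarrow> nat set \<Rightarrow> bool" where
  "Sigma_set 0 S \<longleftrightarrow> decidable_set S"
| "Sigma_set (Suc n) S \<longleftrightarrow>
     (\<exists>P. Sigma_set n (- P) \<and> S = {x. \<exists>y. prod_encode (x, y) \<in> P})"

text \<open>An enumeration may pause: the value \<open>0\<close> outputs nothing, the value \<open>Suc i\<close> outputs \<open>i\<close>.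
  In particular the empty set has an enumeration.\<close>

definition enumerates :: "(nat \<Rightarrow> nat) \<Rightarrow> nat set \<Rightarrow> bool" where
  "enumerates e S \<longleftrightarrow> S = {i. Suc i \<in> range e}"

text \<open>One algorithm which, reading longer and longer prefixes of an arbitrary enumeration of \<open>S\<close>,
  outputs exactly the elements of \<open>S'\<close> (on some prefixes it may output nothing or diverge).\<close>

definition enumerable_from :: "nat set \<Rightarrow> nat set \<Rightarrow> bool" where
  "enumerable_from S S' \<longleftrightarrow> (\<exists>p. \<forall>e. enumerates e S \<longrightarrow>
     S' = {j. \<exists>n. computes p [list_encode (map e [0..<n])] (Suc j)})"

text \<open>The alphabet is \<open>{0, \<dots>, k - 1}\<close>.\<close>

definition seqs :: "nat \<Rightarrow> (nat \<Rightarrow> nat) set" where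
  "seqs k = {x. \<forall>n. x n < k}"

definition seq_dist :: "(nat \<Rightarrow> nat) \<Rightarrow> (nat \<Rightarrow> nat) \<Rightarrow> real" where
  "seq_dist x y = (if x = y then 0 else (1/2) ^ (LEAST n. x n \<noteq> y n))"

lemma Metric_space_seqs: "Metric_space (seqs k) seq_dist"
proof
  show "0 \<le> seq_dist x y" for x y by (simp add: seq_dist_def)
  show "seq_dist x y = seq_dist y x" for x y
    by (simp add: seq_dist_def eq_commute)
  show "seq_dist x y = 0 \<longleftrightarrow> x = y" for x y by (simp add: seq_dist_def)
  show "seq_dist x z \<le> seq_dist x y + seq_dist y z" for x y z
  proof (cases "x = z \<or> x = y \<or> y = z")
    case True
    then show ?thesis by (auto simp: seq_dist_def)
  next
    case False
    define m where "m = (LEAST n. x n \<noteq> z n)"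
    have "x m \<noteq> z m"
      unfolding m_def using False by (intro LeastI_ex[of "\<lambda>n. x n \<noteq> z n"]) (auto simp: fun_eq_iff)
    then consider "x m \<noteq> y m" | "y m \<noteq> z m" by metis
    then have "seq_dist x z \<le> max (seq_dist x y) (seq_dist y z)"
    proof cases
      case 1
      then have "(LEAST n. x n \<noteq> y n) \<le> m" by (rule Least_le)
      then show ?thesis using False
        by (auto simp: seq_dist_def m_def[symmetric] le_max_iff_disj intro!: power_decreasing)
    next
      case 2
      then have "(LEAST n. y n \<noteq> z n) \<le> m" by (rule Least_le)
      then show ?thesis using False
        by (auto simp: seq_dist_def m_def[symmetric] le_max_iff_disj intro!: power_decreasing)
    qed
    also have "\<dots> \<le> seq_dist x y + seq_dist y z" by (simp add: seq_dist_def)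
    finally show ?thesis .
  qed
qed

abbreviation seq_topology :: "nat \<Rightarrow> (nat \<Rightarrow> nat) topology" where
  "seq_topology k \<equiv> Metric_space.mtopology (seqs k) seq_dist"

definition shift :: "(nat \<Rightarrow> nat) \<Rightarrow> nat \<Rightarrow> nat" where
  "shift x = (\<lambda>i. x (Suc i))"

definition ideal_point :: "nat list \<Rightarrow> nat \<Rightarrow> nat" where
  "ideal_point w = (\<lambda>n. if n < length w then w ! n else 0)"

text \<open>The number \<open>i\<close> codes a triple \<open>(w, a, b)\<close>: the \<open>i\<close>-th ideal ball has center \<open>w0\<^sup>\<infinity>\<close> and
  radius \<open>(a + 1) / (b + 1)\<close>. Reduction modulo \<open>k\<close> turns every list of numbers into a word over
  the alphabet.\<close>

definition ball_center :: "nat \<Rightarrow> nat \<Rightarrow> nat \<Rightarrow> nat" where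
  "ball_center k i = ideal_point (map (\<lambda>c. c mod k) (list_decode (fst (prod_decode i))))"

definition ball_radius :: "nat \<Rightarrow> real" where
  "ball_radius i = (case prod_decode (snd (prod_decode i)) of
     (a, b) \<Rightarrow> real (Suc a) / real (Suc b))"

definition closed_ideal_ball :: "nat \<Rightarrow> nat \<Rightarrow> (nat \<Rightarrow> nat) set" where
  "closed_ideal_ball k i = Metric_space.mcball (seqs k) seq_dist (ball_center k i) (ball_radius i)"

lemma ideal_balls_are_enumerated:
  assumes "set w \<subseteq> {..<k}" and "r \<in> \<rat>" and "r > 0"
  shows "\<exists>i. ball_center k i = ideal_point w \<and> ball_radius i = r"
proof -
  from \<open>r \<in> \<rat>\<close> obtain m n where mn: "n \<noteq> 0" "\<bar>r\<bar> = real m / real n"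
    by (rule Rats_abs_nat_div_natE)
  with \<open>r > 0\<close> have "m \<noteq> 0" by (cases "m = 0") auto
  define i where "i = prod_encode (list_encode w, prod_encode (m - 1, n - 1))"
  have "map (\<lambda>c. c mod k) w = w"
    using assms(1) by (intro map_idI) auto
  then have "ball_center k i = ideal_point w" by (simp add: ball_center_def i_def)
  moreover have "ball_radius i = r"
    using mn \<open>m \<noteq> 0\<close> \<open>r > 0\<close> by (simp add: ball_radius_def i_def)
  ultimately show ?thesis by blast
qed

definition computable_map :: "nat \<Rightarrow> ((nat \<Rightarrow> nat) \<Rightarrow> nat \<Rightarrow> nat) \<Rightarrow> bool" where
  "computable_map k T \<longleftrightarrow> T \<in> seqs k \<rightarrow> seqs k \<and>
     (\<exists>\<phi> p. mono \<phi> \<and> computable_fun \<phi> \<and>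
        (\<forall>x\<in>seqs k. \<forall>n. computes p [n, list_encode (map x [0..<\<phi> n])]
                                    (list_encode (map (T x) [0..<n]))))"

definition outer_collection :: "nat \<Rightarrow> (nat \<Rightarrow> nat) set \<Rightarrow> nat set" where
  "outer_collection k K = {i. closed_ideal_ball k i \<inter> K = {}}"

definition Pi_compact :: "nat \<Rightarrow> nat \<Rightarrow> (nat \<Rightarrow> nat) set \<Rightarrow> bool" where
  "Pi_compact k n K \<longleftrightarrow> compactin (seq_topology k) K \<and> Sigma_set n (outer_collection k K)"

definition Pi_complete :: "nat \<Rightarrow> nat \<Rightarrow> (nat \<Rightarrow> nat) set \<Rightarrow> bool" where
  "Pi_complete k n K \<longleftrightarrow> Pi_compact k n K \<and>
     (\<forall>K'. Pi_compact k n K' \<longrightarrow> enumerable_from (outer_collection k K) (outer_collection k K'))"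

definition omega_limit ::
  "nat \<Rightarrow> ((nat \<Rightarrow> nat) \<Rightarrow> nat \<Rightarrow> nat) \<Rightarrow> (nat \<Rightarrow> nat) \<Rightarrow> (nat \<Rightarrow> nat) set" where
  "omega_limit k T x =
     {y \<in> seqs k. \<forall>\<epsilon>>0. \<exists>\<^sub>F n in sequentially. seq_dist ((T ^^ n) x) y < \<epsilon>}"

definition basin ::
  "nat \<Rightarrow> ((nat \<Rightarrow> nat) \<Rightarrow> nat \<Rightarrow> nat) \<Rightarrow> (nat \<Rightarrow> nat) set \<Rightarrow> (nat \<Rightarrow> nat) set" where
  "basin k T A = {x \<in> seqs k. omega_limit k T x \<subseteq> A}"

definition generic_in :: "'a topology \<Rightarrow> 'a set \<Rightarrow> bool" where
  "generic_in X S \<longleftrightarrow> (\<exists>U :: nat \<Rightarrow> 'a set.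
     (\<forall>n. openin X (U n) \<and> X closure_of U n = topspace X) \<and> (\<Inter>n. U n) \<subseteq> S)"

definition meager_in :: "'a topology \<Rightarrow> 'a set \<Rightarrow> bool" where
  "meager_in X S \<longleftrightarrow> S \<subseteq> topspace X \<and> generic_in X (topspace X - S)"

definition topological_attractor ::
  "nat \<Rightarrow> ((nat \<Rightarrow> nat) \<Rightarrow> nat \<Rightarrow> nat) \<Rightarrow> (nat \<Rightarrow> nat) set \<Rightarrow> bool" where
  "topological_attractor k T A \<longleftrightarrow> closedin (seq_topology k) A \<and>
     generic_in (seq_topology k) (basin k T A) \<and>
     \<not> (\<exists>A'. closedin (seq_topology k) A' \<and> A' \<subset> A \<and>
           \<not> meager_in (seq_topology k) (basin k T A'))"

text \<open>For continuous \<open>T\<close> the basin of a closed set is Borel, so the measures below are meaningful.\<close>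

definition metric_attractor ::
  "nat \<Rightarrow> ((nat \<Rightarrow> nat) \<Rightarrow> nat \<Rightarrow> nat) \<Rightarrow> (nat \<Rightarrow> nat) measure \<Rightarrow> (nat \<Rightarrow> nat) set \<Rightarrow> bool" where
  "metric_attractor k T \<mu> A \<longleftrightarrow> closedin (seq_topology k) A \<and>
     emeasure \<mu> (basin k T A) = emeasure \<mu> (space \<mu>) \<and>
     \<not> (\<exists>A'. closedin (seq_topology k) A' \<and> A' \<subset> A \<and> emeasure \<mu> (basin k T A') > 0)"

definition seq_borel :: "nat \<Rightarrow> (nat \<Rightarrow> nat) measure" where
  "seq_borel k = sigma (seqs k) {U. openin (seq_topology k) U}"

definition shift_ergodic :: "nat \<Rightarrow> (nat \<Rightarrow> nat) measure \<Rightarrow> bool" where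
  "shift_ergodic k \<mu> \<longleftrightarrow> sets \<mu> = sets (seq_borel k) \<and> emeasure \<mu> (space \<mu>) = 1 \<and>
     (\<forall>E\<in>sets \<mu>. emeasure \<mu> (shift -` E \<inter> space \<mu>) = emeasure \<mu> E) \<and>
     (\<forall>E\<in>sets \<mu>. shift -` E \<inter> space \<mu> = E \<longrightarrow> emeasure \<mu> E = 0 \<or> emeasure \<mu> E = 1)"

definition full_support :: "nat \<Rightarrow> (nat \<Rightarrow> nat) measure \<Rightarrow> bool" where
  "full_support k \<mu> \<longleftrightarrow>
     (\<forall>U. openin (seq_topology k) U \<and> U \<noteq> {} \<longrightarrow> emeasure \<mu> U > 0)"

end

theory Submission
  imports Defs
begin

text \<open>The alphabet is \<open>{0, 1, 2}\<close>. The map is the shift, except that the first letter \<open>2\<close>, the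
  marker, writes a fixed computable binary sequence, the tape, behind itself while it moves to
  the right by one position per step. Hence the orbit of any point with a marker shadows the shift
  orbit of the tape, and its \<open>\<omega>\<close>-limit is the set \<open>A\<close> of sequences all of whose prefixes occur
  infinitely often in the tape. The points with a marker form a dense open set which has full
  measure for every shift-ergodic measure of full support; so \<open>A\<close> is the only attractor. A cylinder
  misses \<open>A\<close> iff its word occurs only finitely often in the tape, which is a \<open>\<Sigma>\<^sub>2\<close> condition. The
  tape runs through the stages of a universal computation such that, for each \<open>m\<close>, the word
  \<open>01\<^bsup>m+1\<^esup>0\<close> recurs iff \<open>m\<close> lies in a complete \<open>\<Pi>\<^sub>2\<close> set.\<close>

subsection \<open>Computable functions of an environment\<close>

text \<open>One decidable tape has to serve all Pi_2 compact sets, although a condition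
  \<open>\<forall>y. \<exists>w\<close> can only be verified in the limit. It becomes a recurrence
  condition: each longer verified range of \<open>y\<close> pays for one more copy of the word of
  the instance, so a false instance gets finitely many copies. As the tape must be computable,
  halting is replaced by bounded search among numbers that code derivations.

  Relative to the unshifted sequence the marker advances two cells per step, one more than the shift
  discards; this is why the written part grows and fills every fixed window. The initial position of
  the marker only translates the tape, which the omega-limit does not see. The letter 2 never occurs
  on the tape, so on the attractor the map is the shift.\<close>

text \<open>The program works on all sufficiently long prefixes of the environment \<open>e\<close>. This makes
  arities irrelevant: \<open>e i\<close> is the \<open>i\<close>-th variable, for every \<open>i\<close>.\<close>

definition effective :: "((nat \<Rightarrow> nat) \<Rightarrow> nat) \<Rightarrow> bool" where
  "effective F \<longleftrightarrow> (\<exists>p n. \<forall>e m. n \<le> m \<longrightarrow> computes p (map e [0..<m]) (F e))"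

lemma effective_cong: "effective F \<Longrightarrow> (\<And>e. F e = G e) \<Longrightarrow> effective G"
  by (metis ext)

lemma effective_var: "effective (\<lambda>e. e i)"
proof -
  have "computes (Proj i) (map e [0..<m]) (e i)" if "Suc i \<le> m" for e m
    using computes_Proj[of i "map e [0..<m]"] that by simp
  then show ?thesis unfolding effective_def by blast
qed

text \<open>The program for \<open>F\<close> reads only its first \<open>n\<close> variables, so
  finitely many programs from the infinite family \<open>G\<close> enter the composition.\<close>

lemma effective_subst:
  assumes "effective F" and "\<And>i. effective (G i)"
  shows "effective (\<lambda>e. F (\<lambda>i. G i e))"
proof -
  obtain p n where p: "\<And>e m. n \<le> m \<Longrightarrow> computes p (map e [0..<m]) (F e)"
    using assms(1) unfolding effective_def by blast
  have "\<forall>i. \<exists>q k. \<forall>e m. k \<le> m \<longrightarrow> computes q (map e [0..<m]) (G i e)"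
    using assms(2) unfolding effective_def by blast
  then obtain q k where q: "\<And>i e m. k i \<le> m \<Longrightarrow> computes (q i) (map e [0..<m]) (G i e)"
    by metis
  have "computes (Comp p (map q [0..<n])) (map e [0..<m]) (F (\<lambda>i. G i e))"
    if "(\<Sum>i<n. k i) \<le> m" for e m
  proof (rule computes_Comp)
    have "k i \<le> m" if "i < n" for i
      using member_le_sum[of i "{..<n}" k] that \<open>(\<Sum>i<n. k i) \<le> m\<close> by force
    then show "list_all2 (\<lambda>g y. computes g (map e [0..<m]) y) (map q [0..<n])
        (map (\<lambda>i. G i e) [0..<n])"
      by (auto simp: list_all2_conv_all_nth intro!: q)
    show "computes p (map (\<lambda>i. G i e) [0..<n]) (F (\<lambda>i. G i e))" by (rule p) simp
  qed
  then show ?thesis unfolding effective_def by blast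
qed

lemma effective_comp1:
  assumes "effective (\<lambda>e. f (e 0))" and "effective F"
  shows "effective (\<lambda>e. f (F e))"
  using effective_subst[OF assms(1), of "\<lambda>_. F"] assms(2) by simp

lemma effective_comp2:
  assumes "effective (\<lambda>e. f (e 0) (e 1))" and "effective F" and "effective G"
  shows "effective (\<lambda>e. f (F e) (G e))"
  using effective_subst[OF assms(1), of "\<lambda>i. if i = 0 then F else G"] assms(2,3) by simp

lemma effective_comp3:
  assumes "effective (\<lambda>e. f (e 0) (e 1) (e 2))" and "effective F" and "effective G"
    and "effective H"
  shows "effective (\<lambda>e. f (F e) (G e) (H e))"
  using effective_subst[OF assms(1), of "\<lambda>i. if i = 0 then F else if i = 1 then G else H"]
    assms(2-4) by simp

lemma effective_shift: "effective F \<Longrightarrow> effective (\<lambda>e. F (\<lambda>i. e (i + k)))"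
  using effective_subst[of F "\<lambda>i e. e (i + k)"] effective_var by simp

lemma effective_0: "effective (\<lambda>e. 0)"
  unfolding effective_def using computes_Zero by blast

lemma effective_Suc:
  assumes "effective F"
  shows "effective (\<lambda>e. Suc (F e))"
proof (rule effective_comp1[OF _ assms])
  have "computes Succ (map e [0..<m]) (Suc (e 0))" if "1 \<le> m" for e m
    using that computes_Succ by (simp add: upt_conv_Cons)
  then show "effective (\<lambda>e. Suc (e 0))" unfolding effective_def by blast
qed

lemma effective_const: "effective (\<lambda>e. c)"
  by (induction c) (auto intro: effective_0 effective_Suc)

lemma map_upt_extend:
  "map (case_nat a e) [0..<Suc m] = a # map e [0..<m]"
  by (rule nth_equalityI) (auto simp: nth_Cons simp del: upt_Suc split: nat.split)

lemma effective_rec: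
  assumes "effective B" and "effective (\<lambda>e. S (e 0) (e 1) (\<lambda>i. e (i + 2)))" and "effective N"
  shows "effective (\<lambda>e. rec_nat (B e) (\<lambda>m r. S m r e) (N e))"
proof -
  obtain b n1 where b: "\<And>e m. n1 \<le> m \<Longrightarrow> computes b (map e [0..<m]) (B e)"
    using assms(1) unfolding effective_def by blast
  obtain s n2 where s: "\<And>e m. n2 \<le> m \<Longrightarrow>
      computes s (map e [0..<m]) (S (e 0) (e 1) (\<lambda>i. e (i + 2)))"
    using assms(2) unfolding effective_def by blast
  have pr: "computes (PrimRec b s) (k # map e [0..<m]) (rec_nat (B e) (\<lambda>m r. S m r e) k)"
    if "n1 + n2 \<le> m" for k e m
  proof (induction k)
    case 0
    then show ?case using b that by (auto intro: computes_PrimRec_0)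
  next
    case (Suc k)
    let ?r = "rec_nat (B e) (\<lambda>m r. S m r e) k"
    let ?e = "case_nat k (case_nat ?r e)"
    have "computes s (map ?e [0..<Suc (Suc m)]) (S k ?r e)"
      using s[of "Suc (Suc m)" ?e] that by simp
    also have "map ?e [0..<Suc (Suc m)] = k # ?r # map e [0..<m]"
      by (simp only: map_upt_extend)
    finally show ?case using Suc by (auto intro: computes_PrimRec_Suc)
  qed
  have "computes (PrimRec b s) (map e [0..<m]) (rec_nat (B (\<lambda>i. e (Suc i)))
      (\<lambda>m r. S m r (\<lambda>i. e (Suc i))) (e 0))"
    if "Suc (n1 + n2) \<le> m" for e m
    using pr[of "m - 1" "e 0" "\<lambda>i. e (Suc i)"] that
    by (cases m) (simp_all add: map_upt_Suc del: upt_Suc)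
  then have "effective (\<lambda>e. rec_nat (B (\<lambda>i. e (Suc i))) (\<lambda>m r. S m r (\<lambda>i. e (Suc i))) (e 0))"
    unfolding effective_def by blast
  \<comment> \<open>\<open>PrimRec\<close> recurses on variable 0: \<open>N\<close> is substituted
    there, and reading the other variables one index lower restores the parameters.\<close>
  from effective_subst[OF this, of "\<lambda>i. if i = 0 then N else (\<lambda>e. e (i - 1))"]
  show ?thesis using assms(3) effective_var by simp
qed

lemma effective_Least:
  assumes "effective (\<lambda>e. of_bool (P (e 0) (\<lambda>i. e (Suc i))))" and "\<And>e. \<exists>n. P n e"
  shows "effective (\<lambda>e. LEAST n. P n e)"
proof -
  \<comment> \<open>\<open>Minim\<close> searches for the value 0, so the truth value is negated
    first, by a recursion sending 0 to 1 and successors to 0.\<close>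
  have "effective (\<lambda>e. rec_nat 1 (\<lambda>_ _. 0) (of_bool (P (e 0) (\<lambda>i. e (Suc i)))))"
    by (rule effective_rec[OF effective_const _ assms(1)]) (rule effective_const)
  then obtain p k where p: "\<And>e m. k \<le> m \<Longrightarrow> computes p (map e [0..<m])
      (rec_nat 1 (\<lambda>_ _. 0) (of_bool (P (e 0) (\<lambda>i. e (Suc i)))))"
    unfolding effective_def by blast
  have p': "computes p (n # map e [0..<m]) (of_bool (\<not> P n e))" if "k \<le> m" for n e m
    using p[of "Suc m" "case_nat n e"] that
    by (simp add: map_upt_extend del: upt_Suc) (cases "P n e"; simp)
  have "computes (Minim p) (map e [0..<m]) (LEAST n. P n e)" if "k \<le> m" for e m
  proof (rule computes_Minim)
    have "P (LEAST n. P n e) e" using assms(2) by (metis LeastI)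
    then show "computes p ((LEAST n. P n e) # map e [0..<m]) 0"
      using p'[OF that, of "LEAST n. P n e" e] by simp
    show "\<forall>i<(LEAST n. P n e). \<exists>y. computes p (i # map e [0..<m]) (Suc y)"
      using p'[OF that, of _ e] not_less_Least[of _ "\<lambda>n. P n e"] by (metis One_nat_def of_bool_eq(2))
  qed
  then show ?thesis unfolding effective_def by blast
qed

lemma computable_fun_if_effective:
  assumes "effective (\<lambda>e. f (e 0))"
  shows "computable_fun f"
proof -
  obtain p n where p: "\<And>e m. n \<le> m \<Longrightarrow> computes p (map e [0..<m]) (f (e 0))"
    using assms unfolding effective_def by blast
  \<comment> \<open>The single argument is copied into all \<open>n\<close> variables, as the result
    depends on variable 0 only.\<close>
  have "computes (Comp p (map (\<lambda>_. Proj 0) [0..<n])) [x] (f x)" for x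
  proof (rule computes_Comp)
    show "list_all2 (\<lambda>g y. computes g [x] y) (map (\<lambda>_. Proj 0) [0..<n]) (map (\<lambda>_. x) [0..<n])"
      using computes_Proj[of 0 "[x]"] by (auto simp: list_all2_conv_all_nth)
    show "computes p (map (\<lambda>_. x) [0..<n]) (f x)" using p[of n "\<lambda>_. x"] by simp
  qed
  then show ?thesis unfolding computable_fun_def by blast
qed

lemma computable2_if_effective:
  assumes "effective (\<lambda>e. f (e 0) (e 1))"
  obtains p where "\<And>x y. computes p [x, y] (f x y)"
proof -
  obtain p n where p: "\<And>e m. n \<le> m \<Longrightarrow> computes p (map e [0..<m]) (f (e 0) (e 1))"
    using assms unfolding effective_def by blast
  have "computes (Comp p (map (\<lambda>i. if i = 0 then Proj 0 else Proj 1) [0..<n])) [x, y] (f x y)" for x y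
  proof (rule computes_Comp)
    show "list_all2 (\<lambda>g. computes g [x, y]) (map (\<lambda>i. if i = 0 then Proj 0 else Proj 1) [0..<n])
        (map (\<lambda>i. if i = 0 then x else y) [0..<n])"
      using computes_Proj[of 0 "[x, y]"] computes_Proj[of 1 "[x, y]"]
      by (auto simp: list_all2_conv_all_nth)
    show "computes p (map (\<lambda>i. if i = 0 then x else y) [0..<n]) (f x y)"
      using p[of n "\<lambda>i. if i = 0 then x else y"] by simp
  qed
  then show ?thesis using that by blast
qed

section \<open>Closure under arithmetic, decidable predicates and bounded quantifiers\<close>

named_theorems eff

declare effective_var [eff] effective_const [eff] effective_Suc [eff]

lemma effective_add [eff]: "effective F \<Longrightarrow> effective G \<Longrightarrow> effective (\<lambda>e. F e + G e)"
proof (rule effective_comp2[where f = "(+)"])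
  have "effective (\<lambda>e. rec_nat (e 1) (\<lambda>_ r. Suc r) (e 0))" by (intro effective_rec eff)
  moreover have "rec_nat a (\<lambda>_ r. Suc r) b = b + a" for a b :: nat
    by (induction b) simp_all
  ultimately show "effective (\<lambda>e. e 0 + e 1)" by simp
qed

lemma effective_mult [eff]: "effective F \<Longrightarrow> effective G \<Longrightarrow> effective (\<lambda>e. F e * G e)"
proof (rule effective_comp2[where f = "(*)"])
  have "effective (\<lambda>e. rec_nat 0 (\<lambda>_ r. r + e 1) (e 0))" by (intro effective_rec eff)
  moreover have "rec_nat 0 (\<lambda>_ r. r + a) b = b * a" for a b :: nat
    by (induction b) simp_all
  ultimately show "effective (\<lambda>e. e 0 * e 1)" by simp
qed

lemma effective_pow [eff]: "effective F \<Longrightarrow> effective G \<Longrightarrow> effective (\<lambda>e. F e ^ G e)"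
proof (rule effective_comp2[where f = "(^)"])
  have "effective (\<lambda>e. rec_nat 1 (\<lambda>_ r. r * e 0) (e 1))" by (intro effective_rec eff)
  moreover have "rec_nat 1 (\<lambda>_ r. r * a) b = a ^ b" for a b :: nat
    by (induction b) simp_all
  ultimately show "effective (\<lambda>e. e 0 ^ e 1)" by simp
qed

lemma effective_diff [eff]: "effective F \<Longrightarrow> effective G \<Longrightarrow> effective (\<lambda>e. F e - G e)"
proof (rule effective_comp2[where f = "(-)"])
  have "effective (\<lambda>e. rec_nat 0 (\<lambda>i _. i) (e 0))" by (intro effective_rec eff)
  moreover have "rec_nat 0 (\<lambda>i _. i) a = a - 1" for a :: nat by (cases a) simp_all
  ultimately have pred: "effective (\<lambda>e. e 0 - 1)" by simp
  have "effective (\<lambda>e. rec_nat (e 0) (\<lambda>_ r. r - 1) (e 1))"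
    by (intro effective_rec eff effective_comp1[OF pred])
  moreover have "rec_nat a (\<lambda>_ r. r - 1) b = a - b" for a b :: nat
    by (induction b) simp_all
  ultimately show "effective (\<lambda>e. e 0 - e 1)" by simp
qed

abbreviation effective_pred :: "((nat \<Rightarrow> nat) \<Rightarrow> bool) \<Rightarrow> bool" where
  "effective_pred P \<equiv> effective (\<lambda>e. of_bool (P e))"

lemma effective_not [eff]: "effective_pred P \<Longrightarrow> effective_pred (\<lambda>e. \<not> P e)"
proof -
  assume "effective_pred P"
  then have "effective (\<lambda>e. 1 - of_bool (P e))" by (intro eff)
  moreover have "1 - of_bool (P e) = (of_bool (\<not> P e) :: nat)" for e by simp
  ultimately show ?thesis by (rule effective_cong)
qed

lemma effective_conj [eff]:
  "effective_pred P \<Longrightarrow> effective_pred Q \<Longrightarrow> effective_pred (\<lambda>e. P e \<and> Q e)"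
  unfolding of_bool_conj by (intro eff)

lemma effective_disj [eff]:
  "effective_pred P \<Longrightarrow> effective_pred Q \<Longrightarrow> effective_pred (\<lambda>e. P e \<or> Q e)"
  using effective_not[OF effective_conj[OF effective_not effective_not], of P Q] by simp

lemma effective_le [eff]:
  assumes "effective F" and "effective G"
  shows "effective_pred (\<lambda>e. F e \<le> G e)"
proof -
  have "effective (\<lambda>e. 1 - (F e - G e))" by (intro eff assms)
  moreover have "1 - (F e - G e) = of_bool (F e \<le> G e)" for e by simp
  ultimately show ?thesis by (rule effective_cong)
qed

lemma effective_less [eff]:
  "effective F \<Longrightarrow> effective G \<Longrightarrow> effective_pred (\<lambda>e. F e < G e)"
  unfolding less_eq_Suc_le by (intro eff)

lemma effective_eq [eff]:
  "effective F \<Longrightarrow> effective G \<Longrightarrow> effective_pred (\<lambda>e. F e = G e)"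
  unfolding eq_iff by (intro eff)

lemma effective_if [eff]:
  assumes "effective_pred P" and "effective F" and "effective G"
  shows "effective (\<lambda>e. if P e then F e else G e)"
proof -
  have "effective (\<lambda>e. of_bool (P e) * F e + of_bool (\<not> P e) * G e)" by (intro eff assms)
  moreover have "of_bool (P e) * F e + of_bool (\<not> P e) * G e = (if P e then F e else G e)" for e
    by simp
  ultimately show ?thesis by (rule effective_cong)
qed

lemma effective_all_less:
  assumes "effective_pred (\<lambda>e. P (e 0) (\<lambda>i. e (Suc i)))" and "effective N"
  shows "effective_pred (\<lambda>e. \<forall>i<N e. P i e)"
proof -
  have "effective_pred (\<lambda>e. P (e 0) (\<lambda>i. e (i + 2)))"
    using effective_subst[OF assms(1), of "\<lambda>i e. if i = 0 then e 0 else e (Suc i)"]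
      effective_if[OF effective_const effective_var effective_var]
    by (simp add: effective_var)
  then have "effective (\<lambda>e. rec_nat 1 (\<lambda>i r. r * of_bool (P i e)) (N e))"
    by (intro effective_rec[where S = "\<lambda>i r e. r * of_bool (P i e)"] eff assms(2))
  moreover have "rec_nat 1 (\<lambda>i r. r * of_bool (P i e)) n = (of_bool (\<forall>i<n. P i e) :: nat)" for n e
  proof (induction n)
    case (Suc n)
    have "(\<forall>i<Suc n. P i e) \<longleftrightarrow> (\<forall>i<n. P i e) \<and> P n e" by (auto simp: less_Suc_eq)
    with Suc show ?case by simp
  qed simp
  ultimately show ?thesis by (rule effective_cong)
qed

lemma effective_ex_less:
  assumes "effective_pred (\<lambda>e. P (e 0) (\<lambda>i. e (Suc i)))" and "effective N"
  shows "effective_pred (\<lambda>e. \<exists>i<N e. P i e)"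
  using effective_not[OF effective_all_less[OF effective_not[OF assms(1)] assms(2)]] by simp

lemma effective_mod [eff]:
  assumes "effective F" and "effective G"
  shows "effective (\<lambda>e. F e mod G e)"
proof (rule effective_comp2[OF _ assms])
  have ex: "\<exists>q<Suc a. a = q * b + a mod b \<and> (b = 0 \<or> a mod b < b)" for a b :: nat
    by (intro exI[of _ "a div b"]) (auto simp: less_Suc_eq_le intro: mod_less_divisor)
  \<comment> \<open>For \<open>b = 0\<close> the equation forces \<open>r = a\<close>, in agreement
    with \<open>a mod 0 = a\<close>.\<close>
  have "(LEAST r. \<exists>q<Suc a. a = q * b + r \<and> (b = 0 \<or> r < b)) = a mod b" for a b :: nat
    by (rule Least_equality) (use ex in auto)
  moreover have "effective (\<lambda>e. LEAST r. \<exists>q<Suc (e 0). e 0 = q * e 1 + r \<and> (e 1 = 0 \<or> r < e 1))"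
    by (intro effective_Least effective_ex_less eff) (use ex in blast)
  ultimately show "effective (\<lambda>e. e 0 mod e 1)" by simp
qed

subsection \<open>Pairs and lists\<close>

lemma effective_prod_encode [eff]:
  assumes "effective F" and "effective G"
  shows "effective (\<lambda>e. prod_encode (F e, G e))"
proof (rule effective_comp2[OF _ assms])
  have "effective (\<lambda>e. rec_nat 0 (\<lambda>i r. r + Suc i) (e 0 + e 1) + e 0)"
    by (intro effective_rec eff)
  moreover have "rec_nat 0 (\<lambda>i r. r + Suc i) n = triangle n" for n
    by (induction n) simp_all
  ultimately show "effective (\<lambda>e. prod_encode (e 0, e 1))" by (simp add: prod_encode_def)
qed

definition pfst :: "nat \<Rightarrow> nat" where "pfst n = fst (prod_decode n)"
definition psnd :: "nat \<Rightarrow> nat" where "psnd n = snd (prod_decode n)"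

lemma pfst_encode [simp]: "pfst (prod_encode (a, b)) = a"
  and psnd_encode [simp]: "psnd (prod_encode (a, b)) = b"
  by (simp_all add: pfst_def psnd_def)

lemma prod_encode_pfst_psnd [simp]: "prod_encode (pfst n, psnd n) = n"
  by (simp add: pfst_def psnd_def)

lemma pfst_le: "pfst n \<le> n" and psnd_le: "psnd n \<le> n"
  by (metis le_prod_encode_1 prod_encode_pfst_psnd)
    (metis le_prod_encode_2 prod_encode_pfst_psnd)

lemma effective_pfst [eff]:
  assumes "effective F"
  shows "effective (\<lambda>e. pfst (F e))"
proof (rule effective_comp1[OF _ assms])
  have *: "(\<exists>b<Suc n. prod_encode (a, b) = n) \<longleftrightarrow> a = pfst n" for a n
    by (metis le_prod_encode_2 less_Suc_eq_le pfst_encode prod_encode_pfst_psnd psnd_le)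
  have "effective (\<lambda>e. LEAST a. \<exists>b<Suc (e 0). prod_encode (a, b) = e 0)"
    by (intro effective_Least effective_ex_less eff) (simp add: *)
  then show "effective (\<lambda>e. pfst (e 0))" by (simp add: * Least_equality)
qed

lemma effective_psnd [eff]:
  assumes "effective F"
  shows "effective (\<lambda>e. psnd (F e))"
proof (rule effective_comp1[OF _ assms])
  have *: "prod_encode (pfst n, b) = n \<longleftrightarrow> b = psnd n" for b n
    by (metis prod_encode_pfst_psnd psnd_encode)
  have "effective (\<lambda>e. LEAST b. prod_encode (pfst (e 0), b) = e 0)"
    by (intro effective_Least eff) (simp add: *)
  then show "effective (\<lambda>e. psnd (e 0))" by (simp add: * Least_equality)
qed

section \<open>Arithmetic of list codes\<close>

definition lcons :: "nat \<Rightarrow> nat \<Rightarrow> nat" where "lcons a l = Suc (prod_encode (a, l))"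
definition lhd :: "nat \<Rightarrow> nat" where "lhd l = pfst (l - 1)"
definition ltl :: "nat \<Rightarrow> nat" where "ltl l = psnd (l - 1)"
definition lnth :: "nat \<Rightarrow> nat \<Rightarrow> nat" where "lnth l i = lhd ((ltl ^^ i) l)"
definition llen :: "nat \<Rightarrow> nat" where "llen l = (LEAST i. (ltl ^^ i) l = 0)"

lemma list_encode_Cons: "list_encode (x # xs) = lcons x (list_encode xs)"
  by (simp add: lcons_def)

lemma lhd_lcons [simp]: "lhd (lcons a l) = a" and ltl_lcons [simp]: "ltl (lcons a l) = l"
  by (simp_all add: lhd_def ltl_def lcons_def)

lemma lcons_neq_0 [simp]: "lcons a l \<noteq> 0" by (simp add: lcons_def)

lemma lhd_0 [simp]: "lhd 0 = 0" and ltl_0 [simp]: "ltl 0 = 0"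
  using pfst_le[of 0] psnd_le[of 0] by (simp_all add: lhd_def ltl_def)

lemma funpow_ltl_0 [simp]: "(ltl ^^ i) 0 = 0"
  by (induction i) simp_all

lemma funpow_ltl_list_encode: "(ltl ^^ i) (list_encode xs) = list_encode (drop i xs)"
proof (induction i arbitrary: xs)
  case (Suc i)
  then show ?case
    by (cases xs) (simp_all only: funpow_Suc_right o_apply list_encode_Cons ltl_lcons drop_Suc_Cons
        list_encode.simps(1) ltl_0 drop_Nil funpow_ltl_0)
qed simp

text \<open>The default 0 past the end makes a list code denote the sequence continued by zeros,
  which is how ball centers and prefixes of points are read.\<close>

lemma lnth_list_encode: "lnth (list_encode xs) i = (if i < length xs then xs ! i else 0)"
proof (cases "i < length xs")
  case True
  then have "drop i xs = xs ! i # drop (Suc i) xs" by (rule Cons_nth_drop_Suc[symmetric])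
  then show ?thesis using True
    by (simp only: lnth_def funpow_ltl_list_encode list_encode_Cons lhd_lcons if_True)
qed (simp add: lnth_def funpow_ltl_list_encode)

lemma lnth_lcons [simp]: "lnth (lcons a l) 0 = a" "lnth (lcons a l) (Suc i) = lnth l i"
  by (simp_all add: lnth_def funpow_Suc_right del: funpow.simps)

lemma list_encode_eq_0_iff: "list_encode xs = 0 \<longleftrightarrow> xs = []"
  by (cases xs) simp_all

lemma llen_list_encode [simp]: "llen (list_encode xs) = length xs"
  unfolding llen_def funpow_ltl_list_encode list_encode_eq_0_iff
  by (rule Least_equality) auto

lemma lhd_less: "l \<noteq> 0 \<Longrightarrow> lhd l < l" and ltl_less: "l \<noteq> 0 \<Longrightarrow> ltl l < l"
  using pfst_le[of "l - 1"] psnd_le[of "l - 1"] by (simp_all add: lhd_def ltl_def)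

lemma lnth_less:
  assumes "l \<noteq> 0"
  shows "lnth l i < l"
proof -
  have "(ltl ^^ i) l \<le> l" for i
  proof (induction i)
    case (Suc i)
    have "ltl m \<le> m" for m using ltl_less[of m] by (cases "m = 0") auto
    from this[of "(ltl ^^ i) l"] Suc show ?case by simp
  qed simp
  from this[of i] show ?thesis
    using lhd_less[of "(ltl ^^ i) l"] assms by (cases "(ltl ^^ i) l = 0") (auto simp: lnth_def)
qed

lemma effective_lcons [eff]:
  "effective F \<Longrightarrow> effective G \<Longrightarrow> effective (\<lambda>e. lcons (F e) (G e))"
  unfolding lcons_def by (intro eff)

lemma effective_lhd [eff]: "effective F \<Longrightarrow> effective (\<lambda>e. lhd (F e))"
  unfolding lhd_def by (intro eff)

lemma effective_ltl [eff]: "effective F \<Longrightarrow> effective (\<lambda>e. ltl (F e))"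
  unfolding ltl_def by (intro eff)

lemma effective_funpow_ltl:
  assumes "effective F" and "effective G"
  shows "effective (\<lambda>e. (ltl ^^ G e) (F e))"
proof (rule effective_comp2[where f = "\<lambda>l i. (ltl ^^ i) l", OF _ assms])
  have "effective (\<lambda>e. rec_nat (e 0) (\<lambda>_ r. ltl r) (e 1))" by (intro effective_rec eff)
  moreover have "rec_nat l (\<lambda>_ r. ltl r) i = (ltl ^^ i) l" for l i by (induction i) simp_all
  ultimately show "effective (\<lambda>e. (ltl ^^ e 1) (e 0))" by simp
qed

lemma effective_lnth [eff]: "effective F \<Longrightarrow> effective G \<Longrightarrow> effective (\<lambda>e. lnth (F e) (G e))"
  unfolding lnth_def by (intro eff effective_funpow_ltl)

lemma effective_llen [eff]:
  assumes "effective F"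
  shows "effective (\<lambda>e. llen (F e))"
  unfolding llen_def
proof (rule effective_comp1[OF _ assms], intro effective_Least effective_funpow_ltl eff)
  show "\<exists>n. (ltl ^^ n) (e 0) = 0" for e :: "nat \<Rightarrow> nat"
    using funpow_ltl_list_encode[of "length (list_decode (e 0))" "list_decode (e 0)"] by auto
qed

lemma effective_list_encode_map:
  assumes "effective (\<lambda>e. H (e 0) (\<lambda>i. e (Suc i)))" and "effective N"
  shows "effective (\<lambda>e. list_encode (map (\<lambda>i. H i e) [0..<N e]))"
proof -
  \<comment> \<open>\<open>lcons\<close> prepends, so the list is built downwards from its last
    index \<open>N e - 1\<close>.\<close>
  let ?S = "\<lambda>m r e. lcons (H (N e - Suc m) e) r"
  have "effective (\<lambda>e. H (N (\<lambda>i. e (i + 2)) - Suc (e 0)) (\<lambda>i. e (i + 2)))"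
    using effective_subst[OF assms(1),
        of "\<lambda>i e. if i = 0 then N (\<lambda>i. e (i + 2)) - Suc (e 0) else e (Suc i)"]
      effective_if[OF effective_const effective_diff[OF effective_shift[OF assms(2), of 2]
          effective_Suc[OF effective_var[of 0]]] effective_var]
    by (simp add: effective_var)
  then have "effective (\<lambda>e. rec_nat 0 (\<lambda>m r. ?S m r e) (N e))"
    by (intro effective_rec[where S = ?S] eff assms(2))
  moreover have "rec_nat 0 (\<lambda>m r. ?S m r e) k = list_encode (map (\<lambda>i. H i e) [N e - k..<N e])"
    if "k \<le> N e" for k e
    using that
  proof (induction k)
    case (Suc k)
    then have "[N e - Suc k..<N e] = (N e - Suc k) # [N e - k..<N e]"
      by (simp add: upt_conv_Cons Suc_diff_Suc)
    with Suc show ?case by (simp add: list_encode_Cons del: list_encode.simps)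
  qed simp
  ultimately show ?thesis by simp
qed

text \<open>The recursion carries the list of all earlier values, newest first, so the value at
  \<open>k\<close> is at index \<open>d - 1 - k\<close>. The two look-ups \<open>l\<close> and
  \<open>r\<close> are for the two premises of a derivation.\<close>

lemma effective_course_of_values:
  assumes l: "effective (\<lambda>e. l (e 0))" and r: "effective (\<lambda>e. r (e 0))"
    and \<Phi>: "effective (\<lambda>e. \<Phi> (e 0) (e 1) (e 2))"
    and g: "\<And>d. g d = \<Phi> d (if l d < d then g (l d) else 0) (if r d < d then g (r d) else 0)"
  shows "effective (\<lambda>e. g (e 0))"
proof -
  let ?look = "\<lambda>d h k. if k < d then lnth h (d - 1 - k) else 0"
  let ?S = "\<lambda>d h. lcons (\<Phi> d (?look d h (l d)) (?look d h (r d))) h"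
  have "rec_nat 0 ?S d = list_encode (map g (rev [0..<d]))" for d
  proof (induction d)
    case (Suc d)
    have "lnth (list_encode (map g (rev [0..<d]))) (d - 1 - k) = g k" if "k < d" for k
      using that by (simp add: lnth_list_encode rev_nth)
    with Suc g[of d] show ?case
      by (simp add: list_encode_Cons cong: if_cong del: list_encode.simps)
  qed simp
  from this[of "Suc _"] have "lhd (rec_nat 0 ?S (Suc d)) = g d" for d
    by (simp add: list_encode_Cons del: list_encode.simps)
  moreover have "effective (\<lambda>e. lhd (rec_nat 0 ?S (Suc (e 0))))"
    by (intro effective_rec[where S = "\<lambda>d h e. ?S d h"] eff effective_comp3[OF \<Phi>] l r)
  ultimately show ?thesis by (rule effective_cong[rotated])
qed

subsection \<open>A universal enumeration of computations\<close>

definition node :: "nat \<Rightarrow> nat \<Rightarrow> nat \<Rightarrow> nat" where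
  "node t f g = lcons t (lcons f (lcons g 0))"

text \<open>The terminator \<open>node 0 0 0\<close> of an argument list is the program returning 0,
  the code of the empty list.\<close>

primrec prog_code :: "prog \<Rightarrow> nat" where
  "prog_code Zero = node 0 0 0"
| "prog_code Succ = node 1 0 0"
| "prog_code (Proj i) = node 2 i 0"
| "prog_code (Comp f gs) = node 3 (prog_code f) (foldr (node 4) (map prog_code gs) (node 0 0 0))"
| "prog_code (PrimRec f g) = node 5 (prog_code f) (prog_code g)"
| "prog_code (Minim f) = node 7 (prog_code f) 0"

definition tag :: "nat \<Rightarrow> nat" where "tag c = lnth c 0"
definition arg1 :: "nat \<Rightarrow> nat" where "arg1 c = lnth c 1"
definition arg2 :: "nat \<Rightarrow> nat" where "arg2 c = lnth c 2"

lemma node_simps [simp]: "tag (node t f g) = t" "arg1 (node t f g) = f" "arg2 (node t f g) = g"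
  by (simp_all add: node_def tag_def arg1_def arg2_def eval_nat_numeral)

text \<open>Every rule below has at most two premises. For this, argument lists are built by
  programs with tag 4, and the infinitely many premises of \<open>computes_Minim\<close> are checked one by
  one by programs with tag 6.\<close>

inductive runs :: "nat \<Rightarrow> nat \<Rightarrow> nat \<Rightarrow> bool" where
  zero: "tag c = 0 \<Longrightarrow> runs c x 0"
| succ: "tag c = 1 \<Longrightarrow> runs c x (Suc (lhd x))"
| proj: "tag c = 2 \<Longrightarrow> runs c x (lnth x (arg1 c))"
| comp: "tag c = 3 \<Longrightarrow> runs (arg1 c) u y \<Longrightarrow> runs (arg2 c) x u \<Longrightarrow> runs c x y"
| pair: "tag c = 4 \<Longrightarrow> runs (arg1 c) x a \<Longrightarrow> runs (arg2 c) x b \<Longrightarrow> runs c x (lcons a b)"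
| rec_0: "tag c = 5 \<Longrightarrow> lhd x = 0 \<Longrightarrow> runs (arg1 c) (ltl x) y \<Longrightarrow> runs c x y"
| rec_Suc: "tag c = 5 \<Longrightarrow> lhd x = Suc n \<Longrightarrow> runs c (lcons n (ltl x)) r
    \<Longrightarrow> runs (arg2 c) (lcons n (lcons r (ltl x))) y \<Longrightarrow> runs c x y"
| low_0: "tag c = 6 \<Longrightarrow> lhd x = 0 \<Longrightarrow> runs c x 0"
| low_Suc: "tag c = 6 \<Longrightarrow> lhd x = Suc n \<Longrightarrow> runs c (lcons n (ltl x)) b
    \<Longrightarrow> runs (arg1 c) (lcons n (ltl x)) (Suc a) \<Longrightarrow> runs c x 0"
| min: "tag c = 7 \<Longrightarrow> runs (node 6 (arg1 c) 0) (lcons y x) b \<Longrightarrow> runs (arg1 c) (lcons y x) 0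
    \<Longrightarrow> runs c x y"

lemma runs_low_pos:
  "runs c x y \<Longrightarrow> tag c = 6 \<Longrightarrow> m < lhd x \<Longrightarrow> \<exists>a. runs (arg1 c) (lcons m (ltl x)) (Suc a)"
proof (induction rule: runs.induct)
  case (low_Suc c x n b a)
  then show ?case by (cases "m = n") auto
qed auto

text \<open>Uniqueness alone does not carry the induction: for an unbounded search, smaller
  competitors must be refuted. So a tag 6 judgement also records that below its bound all results
  are positive; \<open>runs_low_pos\<close> refutes larger competitors.\<close>

lemma runs_deterministic_aux:
  "runs c x y \<Longrightarrow> (\<forall>z. runs c x z \<longrightarrow> z = y) \<and>
    (tag c = 6 \<longrightarrow> (\<forall>m<lhd x. \<exists>a. \<forall>z. runs (arg1 c) (lcons m (ltl x)) z \<longrightarrow> z = Suc a))"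
proof (induction rule: runs.induct)
  case (min c y x b)
  have "z = y" if "runs c x z" for z
  proof -
    have "\<exists>b. runs (node 6 (arg1 c) 0) (lcons z x) b \<and> runs (arg1 c) (lcons z x) 0"
      using that min.hyps(1) by cases auto
    then obtain b' where b': "runs (node 6 (arg1 c) 0) (lcons z x) b'" "runs (arg1 c) (lcons z x) 0"
      by blast
    have "\<not> z < y" using min.IH(1) b'(2) by fastforce
    moreover have "\<not> y < z" using runs_low_pos[OF b'(1), of y] min.IH(2) by fastforce
    ultimately show ?thesis by simp
  qed
  then show ?case using min.hyps(1) by simp
next
  case (comp c u y x)
  have "z = y" if "runs c x z" for z
  proof -
    have "\<exists>u. runs (arg1 c) u z \<and> runs (arg2 c) x u"
      using that comp.hyps(1,2) by cases auto
    then show ?thesis using comp.IH by blast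
  qed
  then show ?case using comp.hyps(1) by simp
next
  case (zero c x)
  have "z = 0" if "runs c x z" for z
    using that zero by cases auto
  then show ?case using zero by simp
next
  case (succ c x)
  have "z = Suc (lhd x)" if "runs c x z" for z
    using that succ by cases auto
  then show ?case using succ by simp
next
  case (proj c x)
  have "z = lnth x (arg1 c)" if "runs c x z" for z
    using that proj by cases auto
  then show ?case using proj by simp
next
  case (low_0 c x)
  have "z = 0" if "runs c x z" for z
    using that low_0 by cases auto
  then show ?case using low_0 by simp
next
  case (pair c x a b)
  have "z = lcons a b" if "runs c x z" for z
  proof -
    have "\<exists>a b. z = lcons a b \<and> runs (arg1 c) x a \<and> runs (arg2 c) x b"
      using that pair.hyps(1,2) by cases auto
    then show ?thesis using pair.IH by blast
  qed
  then show ?case using pair.hyps(1) by simp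
next
  case (rec_0 c x y)
  have "z = y" if "runs c x z" for z
  proof -
    have "runs (arg1 c) (ltl x) z"
      using that rec_0.hyps(1,2) by cases auto
    then show ?thesis using rec_0.IH by blast
  qed
  then show ?case using rec_0.hyps(1) by simp
next
  case (rec_Suc c x n r y)
  have "z = y" if "runs c x z" for z
  proof -
    have "\<exists>r. runs c (lcons n (ltl x)) r \<and> runs (arg2 c) (lcons n (lcons r (ltl x))) z"
      using that rec_Suc.hyps(1,2) by cases auto
    then show ?thesis using rec_Suc.IH by blast
  qed
  then show ?case using rec_Suc.hyps(1) by simp
next
  case (low_Suc c x n b a)
  have "z = 0" if "runs c x z" for z
    using that low_Suc.hyps(1,2) by cases auto
  moreover have "\<exists>a. \<forall>z. runs (arg1 c) (lcons m (ltl x)) z \<longrightarrow> z = Suc a" if "m < Suc n" for m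
    using that low_Suc.IH low_Suc.hyps(1) by (cases "m = n") auto
  ultimately show ?case using low_Suc.hyps(2) by simp
qed

lemma runs_deterministic: "runs c x y \<Longrightarrow> runs c x z \<Longrightarrow> z = y"
  using runs_deterministic_aux by blast

lemma runs_prog_code: "computes p xs y \<Longrightarrow> runs (prog_code p) (list_encode xs) y"
proof (induction rule: computes.induct)
  case (computes_Zero xs)
  show ?case by (simp add: runs.zero)
next
  case (computes_Succ x xs)
  show ?case using runs.succ[of "prog_code Succ" "lcons x (list_encode xs)"]
    by (simp add: list_encode_Cons del: list_encode.simps)
next
  case (computes_Proj i xs)
  then show ?case
    using runs.proj[of "prog_code (Proj i)" "list_encode xs"] by (simp add: lnth_list_encode)
next
  case (computes_Comp xs gs ys f z)
  from computes_Comp.IH(1)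
  have "runs (foldr (node 4) (map prog_code gs) (node 0 0 0)) (list_encode xs) (list_encode ys)"
  proof (induction rule: list_all2_induct)
    case Nil
    then show ?case by (simp add: runs.zero)
  next
    case (Cons g gs y ys)
    then show ?case
      by (simp add: list_encode_Cons runs.pair del: list_encode.simps)
  qed
  with computes_Comp.IH(2) show ?case by (auto intro: runs.comp)
next
  case (computes_PrimRec_0 f xs y g)
  then show ?case
    using runs.rec_0[of "prog_code (PrimRec f g)" "lcons 0 (list_encode xs)" y]
    by (simp add: list_encode_Cons del: list_encode.simps)
next
  case (computes_PrimRec_Suc f g n xs r y)
  then show ?case
    using runs.rec_Suc[of "prog_code (PrimRec f g)" "lcons (Suc n) (list_encode xs)" n r y]
    by (simp add: list_encode_Cons del: list_encode.simps)
next
  case (computes_Minim f n xs)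
  have "runs (node 6 (prog_code f) 0) (lcons k (list_encode xs)) 0" if "k \<le> n" for k
    using that
  proof (induction k)
    case 0
    show ?case by (simp add: runs.low_0)
  next
    case (Suc k)
    then obtain a where "runs (prog_code f) (list_encode (k # xs)) (Suc a)"
      using computes_Minim.IH(2) by (meson Suc_le_lessD)
    then show ?case using Suc
      by (auto simp: list_encode_Cons simp del: list_encode.simps
          intro: runs.low_Suc[of _ "lcons (Suc k) (list_encode xs)" k 0 a])
  qed
  from this[of n] computes_Minim.IH(1) show ?case
    using runs.min[of "prog_code (Minim f)" n "list_encode xs" 0]
    by (simp add: list_encode_Cons del: list_encode.simps)
qed

text \<open>A number \<open>d\<close> codes a derivation of a judgement \<open>runs c x y\<close>: the list \<open>[c, x, l, r]\<close> with
  codes \<open>l\<close> and \<open>r\<close> of derivations of the premises. The value \<open>y\<close> is recomputed by \<open>dval\<close>, which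
  returns \<open>Suc y\<close>, or \<open>0\<close> if \<open>d\<close> is not a derivation.\<close>

definition dprog :: "nat \<Rightarrow> nat" where "dprog d = lnth d 0"
definition darg :: "nat \<Rightarrow> nat" where "darg d = lnth d 1"
definition dleft :: "nat \<Rightarrow> nat" where "dleft d = lnth d 2"
definition dright :: "nat \<Rightarrow> nat" where "dright d = lnth d 3"

definition deriv_code :: "nat \<Rightarrow> nat \<Rightarrow> nat \<Rightarrow> nat \<Rightarrow> nat" where
  "deriv_code c x l r = lcons c (lcons x (lcons l (lcons r 0)))"

lemma deriv_code_simps [simp]:
  "dprog (deriv_code c x l r) = c" "darg (deriv_code c x l r) = x"
  "dleft (deriv_code c x l r) = l" "dright (deriv_code c x l r) = r"
  by (simp_all add: deriv_code_def dprog_def darg_def dleft_def dright_def 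
      eval_nat_numeral)

lemma deriv_code_greater [simp]: "l < deriv_code c x l r" "r < deriv_code c x l r"
proof -
  have "deriv_code c x l r \<noteq> 0" by (simp add: deriv_code_def)
  then show "l < deriv_code c x l r" "r < deriv_code c x l r"
    using lnth_less[of "deriv_code c x l r" 2] lnth_less[of "deriv_code c x l r" 3]
    by (simp_all flip: dleft_def dright_def)
qed

text \<open>\<open>u\<close> and \<open>v\<close> are the \<open>dval\<close> results of the two
  premises, hence shifted by one. The result of an unbounded search is not an entry of
  \<open>d\<close>; it is read off as the head of the argument of the right premise.\<close>

definition dstep :: "nat \<Rightarrow> nat \<Rightarrow> nat \<Rightarrow> nat" where
  "dstep d u v =
    (let c = dprog d; x = darg d; f = arg1 c; g = arg2 c; p = dprog (dleft d); a = darg (dleft d);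
       q = dprog (dright d); b = darg (dright d) in
     if tag c = 0 then 1
     else if tag c = 1 then Suc (Suc (lhd x))
     else if tag c = 2 then Suc (lnth x f)
     else if tag c = 3 then
       if 0 < u \<and> 0 < v \<and> p = f \<and> a = v - 1 \<and> q = g \<and> b = x then u else 0
     else if tag c = 4 then
       if 0 < u \<and> 0 < v \<and> p = f \<and> a = x \<and> q = g \<and> b = x then Suc (lcons (u - 1) (v - 1)) else 0
     else if tag c = 5 then
       if lhd x = 0 then if 0 < u \<and> p = f \<and> a = ltl x then u else 0
       else if 0 < u \<and> 0 < v \<and> p = c \<and> a = lcons (lhd x - 1) (ltl x) \<and>
            q = g \<and> b = lcons (lhd x - 1) (lcons (u - 1) (ltl x)) then v else 0
     else if tag c = 6 then
       if lhd x = 0 then 1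
       else if 0 < u \<and> 1 < v \<and> p = c \<and> a = lcons (lhd x - 1) (ltl x) \<and>
            q = f \<and> b = lcons (lhd x - 1) (ltl x) then 1 else 0
     else if tag c = 7 then
       if 0 < u \<and> v = 1 \<and> p = node 6 f 0 \<and> a = lcons (lhd b) x \<and> q = f \<and> b = lcons (lhd b) x
       then Suc (lhd b) else 0
     else 0)"

text \<open>The guards fail only at \<open>d = 0\<close>, since entries of a nonzero list code are
  smaller than the code. They ensure termination and give the form required by
  \<open>effective_course_of_values\<close>.\<close>

fun dval :: "nat \<Rightarrow> nat" where
  "dval d = dstep d (if dleft d < d then dval (dleft d) else 0)
                    (if dright d < d then dval (dright d) else 0)"

declare dval.simps [simp del]

lemma runs_if_dval: "dval d = Suc y \<Longrightarrow> runs (dprog d) (darg d) y"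
proof (induction d arbitrary: y rule: less_induct)
  case (less d)
  define c x l r where cx: "c = dprog d" "x = darg d" "l = dleft d" "r = dright d"
  define u where "u = (if l < d then dval l else 0)"
  define v where "v = (if r < d then dval r else 0)"
  have u: "runs (dprog l) (darg l) z" if "u = Suc z" for z
    using that less.IH by (auto simp: u_def split: if_splits)
  have v: "runs (dprog r) (darg r) z" if "v = Suc z" for z
    using that less.IH by (auto simp: v_def split: if_splits)
  have step: "dstep d u v = Suc y"
    using less.prems unfolding dval.simps[of d] u_def v_def cx .
  note defs = step[unfolded dstep_def Let_def, folded cx]
  consider "tag c = 0" | "tag c = 1" | "tag c = 2" | "tag c = 3" | "tag c = 4"
    | "tag c = 5" "lhd x = 0" | n where "tag c = 5" "lhd x = Suc n"
    | "tag c = 6" "lhd x = 0" | n where "tag c = 6" "lhd x = Suc n" | "tag c = 7"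
    using defs by (cases "lhd x") (auto split: if_splits)
  then have "runs c x y"
  proof cases
    case 1
    then show ?thesis using defs by (auto intro: runs.zero)
  next
    case 2
    then show ?thesis using defs by (auto intro: runs.succ)
  next
    case 3
    then show ?thesis using defs by (auto intro: runs.proj)
  next
    case 4
    then have "runs (arg1 c) (v - 1) y" "runs (arg2 c) x (v - 1)"
      using defs u[of y] v[of "v - 1"] by (auto split: if_splits)
    with 4 show ?thesis by (rule runs.comp)
  next
    case 5
    then show ?thesis using defs u v
      by (auto split: if_splits dest!: gr0_implies_Suc intro: runs.pair)
  next
    case 6
    then have "runs (arg1 c) (ltl x) y"
      using defs u[of y] by (auto split: if_splits)
    with 6 show ?thesis by (rule runs.rec_0)
  next
    case 7
    then have "runs c (lcons n (ltl x)) (u - 1)"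
        "runs (arg2 c) (lcons n (lcons (u - 1) (ltl x))) y"
      using defs u[of "u - 1"] v[of y] by (auto split: if_splits)
    with 7 show ?thesis by (rule runs.rec_Suc)
  next
    case 8
    then show ?thesis using defs by (auto intro: runs.low_0)
  next
    case 9
    then have "runs c (lcons n (ltl x)) (u - 1)" "runs (arg1 c) (lcons n (ltl x)) (Suc (v - 2))"
        "y = 0"
      using defs u[of "u - 1"] v[of "Suc (v - 2)"] by (auto split: if_splits)
    with 9 show ?thesis using runs.low_Suc by blast
  next
    case 10
    then have "runs (node 6 (arg1 c) 0) (lcons y x) (u - 1)" "runs (arg1 c) (lcons y x) 0"
      using defs u[of "u - 1"] v[of 0] by (auto split: if_splits)
    with 10 show ?thesis by (rule runs.min)
  qed
  then show ?case by (simp add: cx)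
qed

lemma dval_deriv_code:
  "dval (deriv_code c x l r) = dstep (deriv_code c x l r) (dval l) (dval r)"
  by (simp add: dval.simps[of "deriv_code c x l r"])

lemma dval_if_runs: "runs c x y \<Longrightarrow> \<exists>d. dprog d = c \<and> darg d = x \<and> dval d = Suc y"
proof -
  have *: "\<exists>d. dprog d = c \<and> darg d = x \<and> dval d = Suc y"
    if "dstep (deriv_code c x l r) (dval l) (dval r) = Suc y" for c x y l r
    using that by (intro exI[of _ "deriv_code c x l r"]) (simp add: dval_deriv_code)
  show "runs c x y \<Longrightarrow> ?thesis"
  proof (induction rule: runs.induct)
    case (zero c x)
    then show ?case by (intro *[of _ _ 0 0]) (simp add: dstep_def)
  next
    case (succ c x)
    then show ?case by (intro *[of _ _ 0 0]) (simp add: dstep_def)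
  next
    case (proj c x)
    then show ?case by (intro *[of _ _ 0 0]) (simp add: dstep_def)
  next
    case (comp c u y x)
    then obtain l r where "dprog l = arg1 c" "darg l = u" "dval l = Suc y"
      "dprog r = arg2 c" "darg r = x" "dval r = Suc u" by blast
    with comp.hyps show ?case by (intro *[of _ _ l r]) (simp add: dstep_def)
  next
    case (pair c x a b)
    then obtain l r where "dprog l = arg1 c" "darg l = x" "dval l = Suc a"
      "dprog r = arg2 c" "darg r = x" "dval r = Suc b" by blast
    with pair.hyps show ?case by (intro *[of _ _ l r]) (simp add: dstep_def)
  next
    case (rec_0 c x y)
    then obtain l where "dprog l = arg1 c" "darg l = ltl x" "dval l = Suc y" by blast
    with rec_0.hyps show ?case by (intro *[of _ _ l 0]) (simp add: dstep_def)
  next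
    case (rec_Suc c x n r' y)
    then obtain l r where "dprog l = c" "darg l = lcons n (ltl x)" "dval l = Suc r'"
      "dprog r = arg2 c" "darg r = lcons n (lcons r' (ltl x))" "dval r = Suc y" by blast
    with rec_Suc.hyps show ?case by (intro *[of _ _ l r]) (simp add: dstep_def)
  next
    case (low_0 c x)
    then show ?case by (intro *[of _ _ 0 0]) (simp add: dstep_def)
  next
    case (low_Suc c x n b a)
    then obtain l r where "dprog l = c" "darg l = lcons n (ltl x)" "dval l = Suc b"
      "dprog r = arg1 c" "darg r = lcons n (ltl x)" "dval r = Suc (Suc a)" by blast
    with low_Suc.hyps show ?case by (intro *[of _ _ l r]) (simp add: dstep_def)
  next
    case (min c y x b)
    then obtain l r where "dprog l = node 6 (arg1 c) 0" "darg l = lcons y x" "dval l = Suc b"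
      "dprog r = arg1 c" "darg r = lcons y x" "dval r = Suc 0" by blast
    with min.hyps show ?case by (intro *[of _ _ l r]) (simp add: dstep_def)
  qed
qed

text \<open>As \<open>p\<close> halts on \<open>xs\<close>, determinism of \<open>runs\<close> turns
  the one-way simulation \<open>runs_prog_code\<close> into an equivalence.\<close>

lemma ex_dval_iff:
  assumes "computes p xs y"
  shows "(\<exists>d. dprog d = prog_code p \<and> darg d = list_encode xs \<and> dval d = Suc z) \<longleftrightarrow> z = y"
  using runs_prog_code[OF assms] runs_deterministic runs_if_dval dval_if_runs by metis

lemma effective_dval [eff]:
  assumes "effective F"
  shows "effective (\<lambda>e. dval (F e))"
proof (rule effective_comp1[OF _ assms], rule effective_course_of_values)
  show "effective (\<lambda>e. dleft (e 0))" "effective (\<lambda>e. dright (e 0))"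
    unfolding dleft_def dright_def by (intro eff)+
  show "effective (\<lambda>e. dstep (e 0) (e 1) (e 2))"
    unfolding dstep_def Let_def dprog_def darg_def dleft_def dright_def tag_def arg1_def arg2_def
      node_def by (intro eff)
qed (rule dval.simps)

subsection \<open>A computable sequence whose recurrent words encode a complete set\<close>

text \<open>\<open>m\<close> codes a program and an input \<open>x\<close>; \<open>w\<close> codes a
  number \<open>z\<close> and a derivation that the program returns 0 on the singleton list of
  \<open>((x, y), z)\<close>. Including the derivation makes the relation decidable.\<close>

definition halts_zero :: "nat \<Rightarrow> nat \<Rightarrow> nat \<Rightarrow> bool" where
  "halts_zero m y w \<longleftrightarrow> dval (psnd w) = 1 \<and> dprog (psnd w) = pfst m \<and>
     darg (psnd w) = lcons (prod_encode (prod_encode (psnd m, y), pfst w)) 0"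

definition all_halt :: "nat \<Rightarrow> bool" where
  "all_halt m \<longleftrightarrow> (\<forall>y. \<exists>w. halts_zero m y w)"

lemma Sigma_set_2_reduces_to_all_halt:
  assumes "Sigma_set 2 S"
  shows "\<exists>c. \<forall>x. x \<in> S \<longleftrightarrow> \<not> all_halt (prod_encode (c, x))"
proof -
  obtain P Q where P: "S = {x. \<exists>y. prod_encode (x, y) \<in> P}"
    and Q: "- P = {x. \<exists>y. prod_encode (x, y) \<in> Q}" and "decidable_set (- Q)"
    using assms by (auto simp: numeral_2_eq_2)
  \<comment> \<open>The program decides the complement of \<open>Q\<close>, so its result 0
    certifies membership in \<open>Q\<close>.\<close>
  then obtain p where p: "\<And>n. computes p [n] (of_bool (n \<in> - Q))"
    unfolding decidable_set_def computable_fun_def by blast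
  have "x \<in> S \<longleftrightarrow> \<not> all_halt (prod_encode (prog_code p, x))" for x
  proof -
    have "(\<exists>w. halts_zero (prod_encode (prog_code p, x)) y w) \<longleftrightarrow>
        (\<exists>z d. dprog d = prog_code p \<and>
          darg d = list_encode [prod_encode (prod_encode (x, y), z)] \<and> dval d = Suc 0)" for y
    proof safe
      fix z d
      assume "dprog d = prog_code p" "dval d = Suc 0"
        "darg d = list_encode [prod_encode (prod_encode (x, y), z)]"
      then show "\<exists>w. halts_zero (prod_encode (prog_code p, x)) y w"
        by (intro exI[of _ "prod_encode (z, d)"]) (simp add: halts_zero_def lcons_def)
    qed (auto simp: halts_zero_def lcons_def)
    also have "\<dots> y \<longleftrightarrow> (\<exists>z. prod_encode (prod_encode (x, y), z) \<in> Q)" for y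
      unfolding ex_dval_iff[OF p] by auto
    finally have "all_halt (prod_encode (prog_code p, x)) \<longleftrightarrow> (\<forall>y. prod_encode (x, y) \<in> - P)"
      unfolding all_halt_def Q by simp
    then show ?thesis using P by blast
  qed
  then show ?thesis by blast
qed

definition bounded_search :: "nat \<Rightarrow> nat \<Rightarrow> nat \<Rightarrow> bool" where
  "bounded_search m Y D \<longleftrightarrow> (\<forall>y<Y. \<exists>w<D. halts_zero m y w)"

text \<open>The number \<open>s\<close> codes \<open>(m, Y, D)\<close>. As \<open>D\<close> is minimal, it is determined by \<open>m\<close> and \<open>Y\<close>, so
  \<open>m\<close> belongs to infinitely many successful stages iff arbitrarily large \<open>Y\<close> have some \<open>D\<close>.\<close>

definition stage :: "nat \<Rightarrow> bool" where
  "stage s \<longleftrightarrow> bounded_search (pfst s) (pfst (psnd s)) (psnd (psnd s)) \<and>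
     (\<forall>D<psnd (psnd s). \<not> bounded_search (pfst s) (pfst (psnd s)) D)"

lemma infinite_stages_iff: "infinite {s. stage s \<and> pfst s = m} \<longleftrightarrow> all_halt m"
proof
  assume "all_halt m"
  then obtain w where w: "\<And>y. halts_zero m y (w y)" unfolding all_halt_def by metis
  have "bounded_search m Y (Suc (\<Sum>y<Y. w y))" for Y
    unfolding bounded_search_def
    using w member_le_sum[of _ "{..<Y}" w] by (metis finite_lessThan le_imp_less_Suc lessThan_iff zero_le)
  then have ex: "\<exists>D. bounded_search m Y D" for Y by blast
  define s where "s Y = prod_encode (m, prod_encode (Y, LEAST D. bounded_search m Y D))" for Y
  have "stage (s Y) \<and> pfst (s Y) = m" for Y
    unfolding s_def stage_def using LeastI_ex[OF ex[of Y]] by (auto dest: not_less_Least)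
  then have "range s \<subseteq> {s. stage s \<and> pfst s = m}" by blast
  moreover have "inj s" by (rule injI) (simp add: s_def)
  ultimately show "infinite {s. stage s \<and> pfst s = m}"
    by (meson finite_subset range_inj_infinite)
next
  assume inf: "infinite {s. stage s \<and> pfst s = m}"
  show "all_halt m"
  proof (rule ccontr)
    assume "\<not> all_halt m"
    then obtain y where y: "\<And>w. \<not> halts_zero m y w" unfolding all_halt_def by blast
    \<comment> \<open>A \<open>y\<close> without witness blocks every \<open>Y > y\<close>, and each
      remaining \<open>Y\<close> admits at most one minimal \<open>D\<close>.\<close>
    have "{s. stage s \<and> pfst s = m} \<subseteq>
        (\<lambda>Y. prod_encode (m, prod_encode (Y, LEAST D. bounded_search m Y D))) ` {..y}"
    proof safe
      fix s
      assume "stage s"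
      define Y D where "Y = pfst (psnd s)" and "D = psnd (psnd s)"
      have s: "s = prod_encode (pfst s, prod_encode (Y, D))" by (simp add: Y_def D_def)
      have D: "bounded_search (pfst s) Y D" "\<And>D'. D' < D \<Longrightarrow> \<not> bounded_search (pfst s) Y D'"
        using \<open>stage s\<close> by (simp_all add: stage_def Y_def D_def)
      assume "m = pfst s"
      with D(1) y have "Y \<le> y" unfolding bounded_search_def by (meson not_le)
      have "(LEAST D. bounded_search (pfst s) Y D) = D"
        using D by (intro Least_equality) (auto simp: not_less[symmetric])
      with s \<open>Y \<le> y\<close> show "s \<in> (\<lambda>Y. prod_encode (pfst s, prod_encode (Y,
          LEAST D. bounded_search (pfst s) Y D))) ` {..y}"
        by (intro image_eqI[of _ _ Y]) simp_all
    qed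
    with inf show False using finite_surj by blast
  qed
qed

text \<open>The pairing function cuts the positions into blocks: block \<open>s\<close> starts at \<open>triangle s\<close> and
  has length \<open>s + 1\<close>. It reads \<open>1\<^bsup>m+1\<^esup>0\<dots>0\<close> with \<open>m = pfst s\<close> if stage \<open>s\<close> succeeds, and
  \<open>0\<dots>0\<close> otherwise.\<close>

definition tape :: "nat \<Rightarrow> nat" where
  "tape p = of_bool (stage (pfst p + psnd p) \<and> pfst p \<le> pfst (pfst p + psnd p))"

lemma tape_le_1: "tape p \<le> 1" by (simp add: tape_def)

lemma tape_block: "a \<le> s \<Longrightarrow> tape (triangle s + a) = of_bool (stage s \<and> a \<le> pfst s)"
proof -
  assume "a \<le> s"
  then have "triangle s + a = prod_encode (a, s - a)" by (simp add: prod_encode_def)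
  with \<open>a \<le> s\<close> show ?thesis by (simp add: tape_def)
qed

text \<open>This guarantees a final 0 in every block after block 0, so that the runs of ones in
  these blocks never merge.\<close>

lemma pfst_less: "0 < s \<Longrightarrow> pfst s < s"
proof -
  assume "0 < s"
  have "pfst s \<noteq> s"
  proof
    assume eq: "pfst s = s"
    have "triangle (pfst s + psnd s) + pfst s = s"
      using prod_encode_pfst_psnd[of s] by (simp add: prod_encode_def)
    with eq have "triangle (s + psnd s) = 0" by simp
    then show False using \<open>0 < s\<close> by (cases s) simp_all
  qed
  with pfst_le[of s] show ?thesis by simp
qed

definition marker_word :: "nat \<Rightarrow> nat list" where
  "marker_word m = map (\<lambda>i. of_bool (0 < i \<and> i < m + 2)) [0..<m + 3]"

lemma tape_marker_word_iff:
  "(\<forall>i<m + 3. tape (p + i) = marker_word m ! i) \<longleftrightarrow>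
    tape p = 0 \<and> (\<forall>a\<le>m. tape (Suc p + a) = 1) \<and> tape (Suc p + Suc m) = 0"
  (is "?L \<longleftrightarrow> ?R")
proof
  assume L: ?L
  have w: "tape (p + i) = of_bool (0 < i \<and> i < m + 2)" if "i < m + 3" for i
    using L that by (simp add: marker_word_def)
  have "tape (Suc p + a) = 1" if "a \<le> m" for a
    using w[of "Suc a"] that by simp
  moreover have "tape p = 0" "tape (Suc p + Suc m) = 0"
    using w[of 0] w[of "m + 2"] by simp_all
  ultimately show ?R by blast
next
  assume R: ?R
  show ?L
  proof (intro allI impI)
    fix i
    assume "i < m + 3"
    then consider "i = 0" | "i = m + 2" | a where "i = Suc a" "a \<le> m"
      by (cases i) force+
    then show "tape (p + i) = marker_word m ! i"
      using R by cases (auto simp: marker_word_def)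
  qed
qed

text \<open>From block 2 on, a successful block starts with its only run of ones, preceded by the
  final 0 of the block before. Hence, up to finitely many exceptions, occurrences of the word
  correspond to successful stages of \<open>m\<close>.\<close>

lemma infinite_marker_word_iff:
  "infinite {p. \<forall>i<m + 3. tape (p + i) = marker_word m ! i} \<longleftrightarrow> all_halt m"
proof -
  let ?S = "{s. stage s \<and> pfst s = m}"
  let ?P = "{p. \<forall>i<m + 3. tape (p + i) = marker_word m ! i}"
  have "?P \<subseteq> (\<lambda>s. triangle s - 1) ` ?S"
  proof
    fix p
    assume "p \<in> ?P"
    then have p: "tape p = 0" "\<And>a. a \<le> m \<Longrightarrow> tape (Suc p + a) = 1" "tape (Suc p + Suc m) = 0"
      unfolding mem_Collect_eq tape_marker_word_iff by blast+
    define a s where "a = pfst (Suc p)" and "s = pfst (Suc p) + psnd (Suc p)"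
    have as: "a \<le> s" "Suc p = triangle s + a"
      using prod_encode_pfst_psnd[of "Suc p"] by (simp_all add: a_def s_def prod_encode_def)
    have "stage s \<and> a \<le> pfst s"
      using p(2)[of 0] tape_block[OF as(1)] as(2) by (intro ccontr[of "_ \<and> _"]) simp
    then have s: "stage s" "a \<le> pfst s" by simp_all
    \<comment> \<open>If the run of ones began later in its block, the letter before it would be 1
      as well.\<close>
    have "a = 0"
    proof (rule ccontr)
      assume "a \<noteq> 0"
      then have "p = triangle s + (a - 1)" using as by simp
      with tape_block[of "a - 1" s] s as p(1) show False by simp
    qed
    with as have p_s: "Suc p = triangle s" by simp
    then have "0 < s" by (cases s) simp_all
    then have less: "pfst s < s" by (rule pfst_less)
    have "\<not> pfst s < m"
      using p(2)[of "Suc (pfst s)"] tape_block[of "Suc (pfst s)" s] p_s less by auto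
    moreover have "\<not> m < pfst s"
      using p(3) tape_block[of "Suc m" s] p_s less s by auto
    ultimately have "pfst s = m" by simp
    moreover have "p = triangle s - 1" using p_s by simp
    ultimately show "p \<in> (\<lambda>s. triangle s - 1) ` ?S" using s(1) by blast
  qed
  \<comment> \<open>\<open>2 \<le> s\<close> ensures that the previous block ends in 0; block 0 is
    the single letter 1.\<close>
  moreover have "triangle s - 1 \<in> ?P" if s: "stage s" "2 \<le> s" "pfst s = m" for s
  proof -
    obtain r where r: "s = Suc r" "0 < r" using s(2) by (cases s) auto
    have "triangle s - 1 = triangle r + r" using r by simp
    then have "tape (triangle s - 1) = 0"
      using tape_block[of r r] pfst_less[OF r(2)] by simp
    moreover have "Suc (triangle s - 1) = triangle s" using r by simp
    moreover have "m < s" using s pfst_less[of s] by simp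
    ultimately show ?thesis
      using s tape_block[of "Suc m" s] unfolding mem_Collect_eq tape_marker_word_iff
      by (auto simp: tape_block)
  qed
  then have "(\<lambda>s. triangle s - 1) ` (?S \<inter> {2..}) \<subseteq> ?P" by auto
  moreover have "inj_on (\<lambda>s. triangle s - 1) {2..}"
  proof (rule strict_mono_on_imp_inj_on, rule strict_mono_onI)
    fix r s :: nat
    assume "r \<in> {2..}" "r < s"
    have "triangle r < triangle s"
      using lift_Suc_mono_less[of triangle r s] \<open>r < s\<close> by simp
    moreover have "0 < triangle r" using \<open>r \<in> {2..}\<close> by (cases r) simp_all
    ultimately show "triangle r - 1 < triangle s - 1" by simp
  qed
  moreover have "infinite (?S \<inter> {2..}) \<longleftrightarrow> infinite ?S"
  proof -
    have "?S \<subseteq> ?S \<inter> {2..} \<union> {..<2}" by auto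
    then show ?thesis by (meson finite_Int finite_UnI finite_lessThan finite_subset)
  qed
  ultimately have "infinite ?P \<longleftrightarrow> infinite ?S"
    by (meson finite_imageD finite_imageI finite_subset inj_on_subset inf_le2)
  then show ?thesis by (simp only: infinite_stages_iff)
qed

lemma effective_tape [eff]:
  assumes "effective F"
  shows "effective (\<lambda>e. tape (F e))"
proof (rule effective_comp1[OF _ assms])
  have halts: "effective_pred (\<lambda>e. halts_zero (F e) (G e) (H e))"
    if "effective F" "effective G" "effective H" for F G H
    unfolding halts_zero_def dprog_def darg_def by (intro eff that)
  have search: "effective_pred (\<lambda>e. bounded_search (F e) (G e) (H e))"
    if "effective F" "effective G" "effective H" for F G H
  proof (rule effective_comp3[OF _ that])
    show "effective_pred (\<lambda>e. bounded_search (e 0) (e 1) (e 2))"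
      unfolding bounded_search_def by (intro effective_all_less effective_ex_less halts eff)
  qed
  have "effective_pred (\<lambda>e. stage (e 0))"
    unfolding stage_def by (intro effective_all_less search eff)
  then have stage: "effective_pred (\<lambda>e. stage (F e))" if "effective F" for F
    using effective_comp1[of "\<lambda>s. of_bool (stage s)" F] that by simp
  then show "effective (\<lambda>e. tape (e 0))"
    unfolding tape_def by (intro eff stage)
qed

lemma Sigma_set_2_if_effective:
  assumes "effective_pred (\<lambda>e. R (e 0) (e 1) (e 2))"
  shows "Sigma_set 2 {x. \<exists>y. \<forall>z. \<not> R x y z}"
proof -
  define Q where "Q = {v. R (pfst (pfst v)) (psnd (pfst v)) (psnd v)}"
  define P where "P = - {v. \<exists>z. prod_encode (v, z) \<in> Q}"
  have "effective_pred (\<lambda>e. R (pfst (pfst (e 0))) (psnd (pfst (e 0))) (psnd (e 0)))"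
    by (rule effective_comp3[where f = "\<lambda>x y z. of_bool (R x y z)", OF assms]) (intro eff)+
  then have "effective_pred (\<lambda>e. e 0 \<in> - Q)"
    unfolding Q_def Compl_iff mem_Collect_eq by (rule effective_not)
  then have "Sigma_set 1 (- P)"
    using computable_fun_if_effective[of "\<lambda>v. of_bool (v \<in> - Q)"]
    by (auto simp: P_def decidable_set_def)
  moreover have "{x. \<exists>y. \<forall>z. \<not> R x y z} = {x. \<exists>y. prod_encode (x, y) \<in> P}"
    by (simp add: P_def Q_def)
  ultimately show ?thesis by (auto simp: numeral_2_eq_2)
qed

subsection \<open>The topology of the symbolic space\<close>

text \<open>A first disagreement at \<open>L\<close> means distance \<open>(1/2) ^ L\<close>. This
  translates each ball of positive radius into a condition on finitely many letters.\<close>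

lemma seq_dist_le_iff:
  assumes "0 \<le> r"
  shows "seq_dist x y \<le> r \<longleftrightarrow> (\<forall>n. r < (1/2) ^ n \<longrightarrow> x n = y n)"
proof (cases "x = y")
  case False
  define L where "L = (LEAST n. x n \<noteq> y n)"
  have L: "x L \<noteq> y L"
    unfolding L_def using False by (intro LeastI_ex[of "\<lambda>n. x n \<noteq> y n"]) (auto simp: fun_eq_iff)
  have dist: "seq_dist x y = (1/2) ^ L" using False by (simp add: seq_dist_def L_def)
  show ?thesis
  proof
    assume le: "seq_dist x y \<le> r"
    show "\<forall>n. r < (1/2) ^ n \<longrightarrow> x n = y n"
    proof (intro allI impI, rule ccontr)
      fix n
      assume "r < (1/2) ^ n" "x n \<noteq> y n"
      then have "L \<le> n" unfolding L_def by (simp add: Least_le)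
      then have "(1/2 :: real) ^ n \<le> (1/2) ^ L" by (intro power_decreasing) auto
      with le dist \<open>r < (1/2) ^ n\<close> show False by simp
    qed
  next
    assume "\<forall>n. r < (1/2) ^ n \<longrightarrow> x n = y n"
    with L have "\<not> r < (1/2) ^ L" by blast
    then show "seq_dist x y \<le> r" by (simp add: dist)
  qed
qed (use assms in \<open>simp add: seq_dist_def\<close>)

lemma seq_dist_le_power_iff: "seq_dist x y \<le> (1/2) ^ m \<longleftrightarrow> (\<forall>j<m. x j = y j)"
  by (subst seq_dist_le_iff) (simp_all add: power_strict_decreasing_iff)

lemma ex_half_power_less: "0 < \<epsilon> \<Longrightarrow> \<exists>m. (1/2 :: real) ^ m < \<epsilon>"
  by (rule real_arch_pow_inv) simp_all

lemma openin_seq_iff: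
  "openin (seq_topology k) U \<longleftrightarrow>
    U \<subseteq> seqs k \<and> (\<forall>x\<in>U. \<exists>m. \<forall>y\<in>seqs k. (\<forall>j<m. x j = y j) \<longrightarrow> y \<in> U)"
proof -
  interpret Metric_space "seqs k" seq_dist by (rule Metric_space_seqs)
  have "(\<exists>r>0. mcball x r \<subseteq> U) \<longleftrightarrow> (\<exists>m. \<forall>y\<in>seqs k. (\<forall>j<m. x j = y j) \<longrightarrow> y \<in> U)"
    if x: "x \<in> seqs k" for x
  proof
    assume "\<exists>r>0. mcball x r \<subseteq> U"
    then obtain r where r: "0 < r" "mcball x r \<subseteq> U" by blast
    obtain m where m: "(1/2 :: real) ^ m < r" using ex_half_power_less[OF r(1)] by blast
    have "y \<in> U" if "y \<in> seqs k" "\<forall>j<m. x j = y j" for y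
    proof -
      have "seq_dist x y \<le> (1/2) ^ m" using that by (simp only: seq_dist_le_power_iff)
      then have "y \<in> mcball x r" using m x that(1) by (simp add: in_mcball)
      then show ?thesis using r(2) by blast
    qed
    then show "\<exists>m. \<forall>y\<in>seqs k. (\<forall>j<m. x j = y j) \<longrightarrow> y \<in> U" by blast
  next
    assume "\<exists>m. \<forall>y\<in>seqs k. (\<forall>j<m. x j = y j) \<longrightarrow> y \<in> U"
    then obtain m where "\<forall>y\<in>seqs k. (\<forall>j<m. x j = y j) \<longrightarrow> y \<in> U" by blast
    then have "mcball x ((1/2) ^ m) \<subseteq> U" by (auto simp: in_mcball seq_dist_le_power_iff)
    then show "\<exists>r>0. mcball x r \<subseteq> U" by (intro exI[of _ "(1/2) ^ m"]) simp
  qed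
  then show ?thesis unfolding openin_mtopology_mcball by blast
qed

lemma topspace_seq_topology [simp]: "topspace (seq_topology k) = seqs k"
proof -
  interpret Metric_space "seqs k" seq_dist by (rule Metric_space_seqs)
  show ?thesis by simp
qed

text \<open>Koenig's argument: nested infinite index sets, each fixing one more letter by the
  pigeonhole principle. The index set \<open>I\<close> is arbitrary so that the lemma also applies
  to selected times of an orbit and selected positions on the tape.\<close>

lemma accumulation_point:
  fixes u :: "nat \<Rightarrow> nat \<Rightarrow> nat"
  assumes "infinite I" and u: "\<And>n. n \<in> I \<Longrightarrow> u n \<in> seqs k"
  obtains y where "y \<in> seqs k" "\<And>m. infinite {n\<in>I. \<forall>j<m. u n j = y j}"
proof -
  have "\<exists>B. (infinite B \<and> B \<subseteq> I) \<and> B \<subseteq> A \<and> (\<exists>c. \<forall>n\<in>B. u n m = c)"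
    if A: "infinite A \<and> A \<subseteq> I" for A m
  proof -
    have "(\<lambda>n. u n m) ` A \<subseteq> {..<k}" using A u by (force simp: seqs_def)
    then have "finite ((\<lambda>n. u n m) ` A)" by (rule finite_subset) simp
    then obtain a where "infinite {n \<in> A. u n m = u a m}"
      using pigeonhole_infinite[of A "\<lambda>n. u n m"] A by blast
    then show ?thesis using A by (intro exI[of _ "{n \<in> A. u n m = u a m}"]) auto
  qed
  then have "\<exists>f. \<forall>m. (infinite (f m) \<and> f m \<subseteq> I) \<and>
      f (Suc m) \<subseteq> f m \<and> (\<exists>c. \<forall>n\<in>f (Suc m). u n m = c)"
    using assms(1) by (intro dependent_nat_choice) auto
  then obtain f where f: "\<And>m. infinite (f m) \<and> f m \<subseteq> I"
      "\<And>m. f (Suc m) \<subseteq> f m \<and> (\<exists>c. \<forall>n\<in>f (Suc m). u n m = c)"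
    by blast
  then obtain y where y: "\<And>m n. n \<in> f (Suc m) \<Longrightarrow> u n m = y m" by metis
  have mono: "f n \<subseteq> f m" if "m \<le> n" for m n
    using that by (induction rule: dec_induct) (use f(2) in blast)+
  have sub: "f m \<subseteq> {n\<in>I. \<forall>j<m. u n j = y j}" for m
  proof
    fix n
    assume n: "n \<in> f m"
    have "u n j = y j" if "j < m" for j
      using y[of n j] mono[of "Suc j" m] that n by auto
    with n f(1)[of m] show "n \<in> {n\<in>I. \<forall>j<m. u n j = y j}" by blast
  qed
  have "infinite {n\<in>I. \<forall>j<m. u n j = y j}" for m
    using infinite_super[OF sub[of m]] f(1)[of m] by simp
  moreover have "y m < k" for m
  proof -
    obtain n where n: "n \<in> f (Suc m)" using f(1)[of "Suc m"] infinite_imp_nonempty by blast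
    then have "u n \<in> seqs k" using f(1)[of "Suc m"] u by blast
    then have "u n m < k" by (simp add: seqs_def)
    with y[OF n] show ?thesis by simp
  qed
  ultimately show ?thesis by (intro that[of y]) (simp_all add: seqs_def)
qed

lemma compact_space_seq_topology: "compact_space (seq_topology k)"
proof -
  interpret Metric_space "seqs k" seq_dist by (rule Metric_space_seqs)
  have "\<exists>l r. l \<in> seqs k \<and> strict_mono r \<and> limitin mtopology (\<sigma> \<circ> r) l sequentially"
    if "range \<sigma> \<subseteq> seqs k" for \<sigma> :: "nat \<Rightarrow> nat \<Rightarrow> nat"
  proof -
    have \<sigma>: "\<sigma> n \<in> seqs k" for n using that by blast
    obtain y where y: "y \<in> seqs k" "\<And>m. infinite {n\<in>UNIV. \<forall>j<m. \<sigma> n j = y j}"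
      using accumulation_point[of UNIV \<sigma> k] \<sigma> by auto
    have "\<exists>n'. (\<forall>j<Suc m. \<sigma> n' j = y j) \<and> n < n'" for m n
      using y(2)[of "Suc m"] unfolding infinite_nat_iff_unbounded by auto
    then have "\<exists>r. \<forall>m. (\<forall>j<m. \<sigma> (r m) j = y j) \<and> r m < r (Suc m)"
      by (intro dependent_nat_choice) auto
    then obtain r where r: "\<And>m. \<forall>j<m. \<sigma> (r m) j = y j" "\<And>m. r m < r (Suc m)" by blast
    have "limitin mtopology (\<sigma> \<circ> r) y sequentially"
      unfolding limitin_metric
    proof (intro conjI allI impI y(1))
      fix \<epsilon> :: real
      assume "0 < \<epsilon>"
      then obtain m where m: "(1/2 :: real) ^ m < \<epsilon>" using ex_half_power_less by blast
      have "seq_dist ((\<sigma> \<circ> r) n) y < \<epsilon>" if "m \<le> n" for n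
      proof -
        have "seq_dist ((\<sigma> \<circ> r) n) y \<le> (1/2) ^ m"
          unfolding seq_dist_le_power_iff using r(1)[of n] that by auto
        with m show ?thesis by simp
      qed
      then show "\<forall>\<^sub>F n in sequentially. (\<sigma> \<circ> r) n \<in> seqs k \<and> seq_dist ((\<sigma> \<circ> r) n) y < \<epsilon>"
        using \<sigma> unfolding eventually_sequentially by auto
    qed
    then show ?thesis using y(1) strict_mono_Suc_iff r(2) by blast
  qed
  then have "compactin mtopology (seqs k)" unfolding compactin_sequentially by blast
  then show ?thesis by (simp add: compact_space_def)
qed

text \<open>Baire's theorem, available because a compact metric space is complete. It turns
  genericity or meagerness of a basin into a marked point inside or outside it.\<close>

lemma generic_meets_open:
  assumes "generic_in (seq_topology k) S" and "openin (seq_topology k) G" and "G \<noteq> {}"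
  shows "S \<inter> G \<noteq> {}"
proof -
  interpret Metric_space "seqs k" seq_dist by (rule Metric_space_seqs)
  obtain U :: "nat \<Rightarrow> _" where U: "\<And>n. openin mtopology (U n)" "\<And>n. mtopology closure_of U n = seqs k"
    "(\<Inter>n. U n) \<subseteq> S"
    using assms(1) unfolding generic_in_def topspace_seq_topology by blast
  have "mtopology closure_of (\<Inter>n. U n) = seqs k"
    using metric_Baire_category[of "range U"] U
      compact_space_imp_mcomplete[OF compact_space_seq_topology] by auto
  moreover obtain x where "x \<in> G" using assms(3) by blast
  moreover from this have "x \<in> seqs k" using openin_subset[OF assms(2)] by auto
  ultimately have "x \<in> mtopology closure_of (\<Inter>n. U n)" by blast
  then obtain z where "z \<in> (\<Inter>n. U n)" "z \<in> G"
    using \<open>x \<in> G\<close> assms(2) unfolding in_closure_of by blast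
  then show ?thesis using U(3) by blast
qed

lemma omega_limit_iff:
  "y \<in> omega_limit k T x \<longleftrightarrow>
    y \<in> seqs k \<and> (\<forall>m. infinite {n. \<forall>j<m. (T ^^ n) x j = y j})"
proof -
  have "(\<forall>\<epsilon>>0. \<exists>\<^sub>F n in sequentially. seq_dist ((T ^^ n) x) y < \<epsilon>) \<longleftrightarrow>
      (\<forall>m. \<exists>\<^sub>F n in sequentially. seq_dist ((T ^^ n) x) y \<le> (1/2) ^ m)" (is "?L \<longleftrightarrow> ?R")
  proof
    assume L: ?L
    show ?R
    proof
      fix m
      have "\<exists>\<^sub>F n in sequentially. seq_dist ((T ^^ n) x) y < (1/2) ^ m" using L by simp
      then show "\<exists>\<^sub>F n in sequentially. seq_dist ((T ^^ n) x) y \<le> (1/2) ^ m"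
        by (rule frequently_elim1) simp
    qed
  next
    assume R: ?R
    show ?L
    proof (intro allI impI)
      fix \<epsilon> :: real
      assume "0 < \<epsilon>"
      then obtain m where m: "(1/2 :: real) ^ m < \<epsilon>" using ex_half_power_less by blast
      from R have "\<exists>\<^sub>F n in sequentially. seq_dist ((T ^^ n) x) y \<le> (1/2) ^ m" ..
      then show "\<exists>\<^sub>F n in sequentially. seq_dist ((T ^^ n) x) y < \<epsilon>"
        by (rule frequently_elim1) (use m in simp)
    qed
  qed
  then show ?thesis
    by (simp add: omega_limit_def seq_dist_le_power_iff frequently_cofinite
        flip: cofinite_eq_sequentially)
qed

section \<open>Borel sets and ergodic measures\<close>

lemma space_seq_borel: "space (seq_borel k) = seqs k"
  and open_in_seq_borel: "openin (seq_topology k) U \<Longrightarrow> U \<in> sets (seq_borel k)"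
proof -
  have *: "{U. openin (seq_topology k) U} \<subseteq> Pow (seqs k)" using openin_subset by fastforce
  show "space (seq_borel k) = seqs k" unfolding seq_borel_def using * by (rule space_measure_of)
  show "openin (seq_topology k) U \<Longrightarrow> U \<in> sets (seq_borel k)"
    unfolding seq_borel_def using * by (simp add: sets_measure_of)
qed

text \<open>Visiting \<open>c\<close> infinitely often is a shift-invariant event, unlike visiting
  it once. All \<open>G N\<close> have equal measure by invariance of \<open>\<mu>\<close>, so
  continuity from above gives both events the same measure. It is positive since \<open>G 0\<close>
  is open and nonempty, hence 1 by ergodicity.\<close>

lemma AE_visits_letter:
  assumes erg: "shift_ergodic k \<mu>" and full: "full_support k \<mu>" and "c < k"
  shows "emeasure \<mu> {x\<in>seqs k. \<exists>n. x n = c} = 1"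
proof -
  define G where "G N = {x\<in>seqs k. \<exists>n\<ge>N. x n = c}" for N
  define E where "E = (\<Inter>N. G N)"
  have sets: "sets \<mu> = sets (seq_borel k)" and one: "emeasure \<mu> (space \<mu>) = 1"
    and inv: "\<And>A. A \<in> sets \<mu> \<Longrightarrow> emeasure \<mu> (shift -` A \<inter> space \<mu>) = emeasure \<mu> A"
    and trivial: "\<And>A. A \<in> sets \<mu> \<Longrightarrow> shift -` A \<inter> space \<mu> = A \<Longrightarrow>
      emeasure \<mu> A = 0 \<or> emeasure \<mu> A = 1"
    using erg unfolding shift_ergodic_def by blast+
  have space: "space \<mu> = seqs k"
    using sets_eq_imp_space_eq[OF sets] by (simp add: space_seq_borel)
  have open_G: "openin (seq_topology k) (G N)" for N
    unfolding openin_seq_iff G_def by (auto, metis lessI)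
  then have G: "G N \<in> sets \<mu>" for N using open_in_seq_borel sets by blast
  have shift_G: "shift -` G N \<inter> space \<mu> = G (Suc N)" for N
  proof -
    have "(\<exists>n\<ge>N. x (Suc n) = c) \<longleftrightarrow> (\<exists>n\<ge>Suc N. x n = c)" for x :: "nat \<Rightarrow> nat"
      by (metis Suc_le_D Suc_le_mono)
    then show ?thesis by (auto simp: G_def space shift_def seqs_def)
  qed
  have measure_G: "emeasure \<mu> (G N) = emeasure \<mu> (G 0)" for N
    by (induction N) (use inv[OF G] shift_G in auto)
  have dec: "decseq G" by (auto simp: decseq_def G_def) (metis le_trans)
  have "emeasure \<mu> (G 0) \<le> 1" using emeasure_space[of \<mu> "G 0"] one by simp
  then have finite: "emeasure \<mu> (G 0) \<noteq> \<infinity>" by (auto simp: top_unique)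
  have "emeasure \<mu> E = (INF N. emeasure \<mu> (G N))"
    unfolding E_def
    by (rule INF_emeasure_decseq'[symmetric, OF G dec]) (use finite in blast)
  also have "\<dots> = (INF N :: nat. emeasure \<mu> (G 0))" by (intro INF_cong measure_G refl)
  finally have E_G: "emeasure \<mu> E = emeasure \<mu> (G 0)" by simp
  have "(\<lambda>_. c) \<in> G 0" using \<open>c < k\<close> by (simp add: G_def seqs_def)
  then have "emeasure \<mu> (G 0) > 0" using full open_G unfolding full_support_def by blast
  moreover have "E \<in> sets \<mu>" unfolding E_def using G by blast
  moreover have "shift -` E \<inter> space \<mu> = E"
  proof -
    have "shift -` E \<inter> space \<mu> = (\<Inter>N. G (Suc N))" unfolding E_def using shift_G by blast
    also have "\<dots> = E" unfolding E_def 
    proof (intro equalityI INT_greatest)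
      show "(\<Inter>N. G (Suc N)) \<subseteq> G N" for N using decseqD[OF dec, of N "Suc N"] by auto
    qed auto
    finally show ?thesis .
  qed
  ultimately have "emeasure \<mu> (G 0) = 1" using trivial E_G by fastforce
  then show ?thesis by (simp add: G_def)
qed

subsection \<open>The map and its attractor\<close>

text \<open>The minimum of \<open>n\<close> and the position of the first 2. The cut-off keeps the
  search primitive recursive and meaningful without a marker.\<close>

primrec first_marker :: "(nat \<Rightarrow> nat) \<Rightarrow> nat \<Rightarrow> nat" where
  "first_marker x 0 = 0"
| "first_marker x (Suc n) =
     (if first_marker x n = n \<and> x n \<noteq> 2 then Suc n else first_marker x n)"

text \<open>The map shifts the sequence, but the marker moves on: with the first marker at \<open>L\<close>, the
  sequence \<open>w2\<dots>\<close> becomes the shift of \<open>wab22\<dots>\<close> with \<open>a\<close>, \<open>b\<close> at the positions \<open>2L\<close>, \<open>2L + 1\<close> of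
  the tape. As the marker is then at \<open>L + 1\<close>, consecutive pairs of the tape are appended.\<close>

definition step :: "(nat \<Rightarrow> nat) \<Rightarrow> nat \<Rightarrow> nat" where
  "step x i = (let L = first_marker x (i + 2) in
     if L = i + 2 then x (Suc i) else if i \<le> L then tape (L + Suc i) else 2)"

definition attractor :: "(nat \<Rightarrow> nat) set" where
  "attractor = {y. \<forall>m. infinite {p. \<forall>j<m. tape (p + j) = y j}}"

lemma first_marker_eq_self: "(\<And>j. j < n \<Longrightarrow> x j \<noteq> 2) \<Longrightarrow> first_marker x n = n"
  by (induction n) auto

lemma first_marker_eq:
  assumes "x L = 2" and "\<And>j. j < L \<Longrightarrow> x j \<noteq> 2" and "L < n"
  shows "first_marker x n = L"
  using assms(3)
proof (induction n)
  case (Suc n)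
  show ?case
  proof (cases "L = n")
    case True
    then show ?thesis using assms(1) first_marker_eq_self[of L x] assms(2) by simp
  next
    case False
    with Suc show ?thesis by simp
  qed
qed simp

lemma first_marker_cong:
  "(\<And>j. j < n \<Longrightarrow> x j = y j) \<Longrightarrow> first_marker x n = first_marker y n"
  by (induction n) auto

lemma step_no_marker: "(\<And>j. x j \<noteq> 2) \<Longrightarrow> step x = shift x"
  by (rule ext) (simp add: step_def shift_def first_marker_eq_self)

lemma step_marker:
  assumes "x L = 2" and "\<And>j. j < L \<Longrightarrow> x j \<noteq> 2"
  shows "step x i = (if Suc i < L then x (Suc i) else if i \<le> L then tape (L + Suc i) else 2)"
proof (cases "Suc i < L")
  case True
  then have "first_marker x (i + 2) = i + 2"
    using assms(2) by (intro first_marker_eq_self) auto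
  with True show ?thesis by (simp add: step_def)
next
  case False
  then have "first_marker x (i + 2) = L"
    using assms by (intro first_marker_eq) auto
  with False show ?thesis by (simp add: step_def)
qed

lemma step_cong:
  assumes "\<And>j. j < Suc n \<Longrightarrow> x j = y j" and "i < n"
  shows "step x i = step y i"
proof -
  have "first_marker x (i + 2) = first_marker y (i + 2)"
    using assms by (intro first_marker_cong) auto
  moreover have "x (Suc i) = y (Suc i)" using assms by simp
  ultimately show ?thesis by (simp only: step_def)
qed

lemma step_funpow_cong:
  "(\<And>j. j < t + n \<Longrightarrow> x j = y j) \<Longrightarrow> i < n \<Longrightarrow> (step ^^ t) x i = (step ^^ t) y i"
proof (induction t arbitrary: n i)
  case (Suc t)
  have "(step ^^ t) x j = (step ^^ t) y j" if "j < Suc n" for j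
    using Suc.IH[of "Suc n" j] Suc.prems(1) that by simp
  then have "step ((step ^^ t) x) i = step ((step ^^ t) y) i"
    using Suc.prems(2) by (rule step_cong)
  then show ?case by simp
qed simp

lemma step_in_seqs: "x \<in> seqs 3 \<Longrightarrow> step x \<in> seqs 3"
  using tape_le_1 by (auto simp: seqs_def step_def Let_def intro: le_less_trans[of _ 1])

lemma step_funpow_in_seqs: "x \<in> seqs 3 \<Longrightarrow> (step ^^ t) x \<in> seqs 3"
  by (induction t) (auto intro: step_in_seqs)

text \<open>In the coordinate \<open>q = i + t\<close>, which undoes the shift, the marker runs from
  \<open>L\<close> to \<open>L + 2 * t\<close> and leaves \<open>tape (L + q)\<close> in each cell
  it passes. The range of \<open>i\<close> includes the marker itself, as the next step depends on
  it.\<close>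

lemma step_funpow_marker:
  assumes "x L = 2" and "\<And>j. j < L \<Longrightarrow> x j \<noteq> 2"
  shows "i \<le> L + t \<Longrightarrow> (step ^^ t) x i =
    (if i + t < L then x (i + t) else if i < L + t then tape (L + i + t) else 2)"
proof (induction t arbitrary: i)
  case (Suc t)
  have "tape p \<noteq> 2" for p using tape_le_1[of p] by simp
  then have "(step ^^ t) x (L + t) = 2" "\<And>j. j < L + t \<Longrightarrow> (step ^^ t) x j \<noteq> 2"
    using Suc.IH assms by auto
  from step_marker[of "(step ^^ t) x", OF this] show ?case
    using Suc.IH[of "Suc i"] Suc.prems by (auto simp: add_ac)
qed (use assms in auto)

lemma attractor_le_1: "y \<in> attractor \<Longrightarrow> y j \<le> 1"
proof -
  assume "y \<in> attractor"
  then have "infinite {p. \<forall>i<Suc j. tape (p + i) = y i}" unfolding attractor_def by blast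
  then obtain p where "tape (p + j) = y j" using infinite_imp_nonempty by blast
  then show ?thesis using tape_le_1 by metis
qed

lemma attractor_subset: "attractor \<subseteq> seqs 3"
  using attractor_le_1 by (auto simp: seqs_def intro: le_less_trans[of _ 1])

lemma omega_limit_marker:
  assumes "x L = 2" and "\<And>j. j < L \<Longrightarrow> x j \<noteq> 2"
  shows "omega_limit 3 step x = attractor"
proof -
  \<comment> \<open>By time \<open>m + L\<close> the initial word has been shifted out and the
    marker has left the window of \<open>m\<close> letters.\<close>
  have eq: "(step ^^ t) x j = tape (t + L + j)" if "m + L \<le> t" "j < m" for t j m
    using step_funpow_marker[of x L j t] assms that by (simp add: add_ac)
  have "infinite {t. \<forall>j<m. (step ^^ t) x j = y j} \<longleftrightarrow> infinite {p. \<forall>j<m. tape (p + j) = y j}" for m y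
  proof
    assume inf: "infinite {t. \<forall>j<m. (step ^^ t) x j = y j}"
    show "infinite {p. \<forall>j<m. tape (p + j) = y j}"
      unfolding infinite_nat_iff_unbounded_le
    proof
      fix N
      obtain t where "N + (m + L) \<le> t" "\<forall>j<m. (step ^^ t) x j = y j"
        using inf unfolding infinite_nat_iff_unbounded_le by blast
      with eq[of m t] show "\<exists>n\<ge>N. n \<in> {p. \<forall>j<m. tape (p + j) = y j}"
        by (intro exI[of _ "t + L"]) simp
    qed
  next
    assume inf: "infinite {p. \<forall>j<m. tape (p + j) = y j}"
    show "infinite {t. \<forall>j<m. (step ^^ t) x j = y j}"
      unfolding infinite_nat_iff_unbounded_le
    proof
      fix N
      obtain p where "N + (m + L) + L \<le> p" "\<forall>j<m. tape (p + j) = y j"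
        using inf unfolding infinite_nat_iff_unbounded_le by blast
      with eq[of m "p - L"] show "\<exists>n\<ge>N. n \<in> {t. \<forall>j<m. (step ^^ t) x j = y j}"
        by (intro exI[of _ "p - L"]) simp
    qed
  qed
  then show ?thesis
    using attractor_subset by (auto simp: omega_limit_iff attractor_def)
qed

definition marked :: "(nat \<Rightarrow> nat) set" where
  "marked = {x \<in> seqs 3. \<exists>n. x n = 2}"

lemma omega_limit_marked: "x \<in> marked \<Longrightarrow> omega_limit 3 step x = attractor"
proof -
  assume "x \<in> marked"
  then have ex: "\<exists>n. x n = 2" by (simp add: marked_def)
  show ?thesis
  proof (rule omega_limit_marker)
    show "x (LEAST n. x n = 2) = 2" using ex by (rule LeastI_ex)
    show "x j \<noteq> 2" if "j < (LEAST n. x n = 2)" for j using that by (rule not_less_Least)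
  qed
qed

text \<open>Marked points share one omega-limit, so a basin contains all of them or none. Both
  notions of attractor reduce to this dichotomy.\<close>

lemma mem_basin_iff_if_marked: "x \<in> marked \<Longrightarrow> x \<in> basin 3 step B \<longleftrightarrow> attractor \<subseteq> B"
  by (auto simp: basin_def omega_limit_marked) (auto simp: marked_def)

lemma openin_marked: "openin (seq_topology 3) marked"
  unfolding openin_seq_iff marked_def by auto (metis lessI)

lemma closure_of_marked: "seq_topology 3 closure_of marked = topspace (seq_topology 3)"
proof
  show "topspace (seq_topology 3) \<subseteq> seq_topology 3 closure_of marked"
  proof
    fix x
    assume x: "x \<in> topspace (seq_topology 3)"
    have "\<exists>y. y \<in> marked \<and> y \<in> U" if "x \<in> U" "openin (seq_topology 3) U" for U
    proof -
      obtain m where m: "\<forall>y\<in>seqs 3. (\<forall>j<m. x j = y j) \<longrightarrow> y \<in> U"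
        using \<open>openin (seq_topology 3) U\<close> \<open>x \<in> U\<close> unfolding openin_seq_iff by blast
      have "x(m := 2) \<in> marked"
        using x unfolding topspace_seq_topology by (auto simp: marked_def seqs_def)
      moreover from this have "x(m := 2) \<in> U" using m by (simp add: marked_def)
      ultimately show ?thesis by blast
    qed
    with x show "x \<in> seq_topology 3 closure_of marked" unfolding in_closure_of by blast
  qed
qed (rule closure_of_subset_topspace)

lemma closedin_attractor: "closedin (seq_topology 3) attractor"
proof -
  have "openin (seq_topology 3) (seqs 3 - attractor)"
    unfolding openin_seq_iff
  proof (intro conjI ballI)
    fix x
    assume "x \<in> seqs 3 - attractor"
    then obtain m where m: "finite {p. \<forall>j<m. tape (p + j) = x j}" by (auto simp: attractor_def)
    have "y \<notin> attractor" if "\<forall>j<m. x j = y j" for y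
    proof -
      have "{p. \<forall>j<m. tape (p + j) = y j} = {p. \<forall>j<m. tape (p + j) = x j}" using that by auto
      with m have "\<not> infinite {p. \<forall>j<m. tape (p + j) = y j}" by simp
      then show ?thesis unfolding attractor_def by blast
    qed
    then show "\<exists>m. \<forall>y\<in>seqs 3. (\<forall>j<m. x j = y j) \<longrightarrow> y \<in> seqs 3 - attractor" by blast
  qed blast
  then show ?thesis using attractor_subset by (simp add: closedin_def)
qed

lemma compactin_attractor: "compactin (seq_topology 3) attractor"
  by (rule closedin_compact_space[OF compact_space_seq_topology closedin_attractor])

text \<open>For surjectivity: an occurrence of a prefix of \<open>y\<close>, except at position 0,
  is preceded by 0 or 1. If neither extension of \<open>y\<close> to the left were in the attractor,
  some prefix of \<open>y\<close> would occur only finitely often.\<close>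

lemma image_step_attractor: "step ` attractor = attractor"
proof -
  have step: "step y = shift y" if "y \<in> attractor" for y
  proof (rule step_no_marker)
    show "y j \<noteq> 2" for j using attractor_le_1[OF that, of j] by simp
  qed
  have "shift y \<in> attractor" if y: "y \<in> attractor" for y
    unfolding attractor_def
  proof safe
    fix m
    assume fin: "finite {p. \<forall>j<m. tape (p + j) = shift y j}"
    have "Suc ` {p. \<forall>j<Suc m. tape (p + j) = y j} \<subseteq> {p. \<forall>j<m. tape (p + j) = shift y j}"
    proof safe
      fix p j
      assume "\<forall>j<Suc m. tape (p + j) = y j" "j < m"
      then have "tape (p + Suc j) = y (Suc j)" by blast
      then show "tape (Suc p + j) = shift y j" by (simp add: shift_def)
    qed
    with fin have "finite {p. \<forall>j<Suc m. tape (p + j) = y j}"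
      by (meson finite_imageD finite_subset inj_Suc inj_on_subset subset_UNIV)
    with y show False unfolding attractor_def by blast
  qed
  moreover have "\<exists>y'\<in>attractor. shift y' = y" if y: "y \<in> attractor" for y
  proof -
    let ?c = "\<lambda>c. case_nat c y"
    have "?c 0 \<in> attractor \<or> ?c 1 \<in> attractor"
    proof (rule ccontr)
      assume "\<not> ?thesis"
      then have "\<exists>m0. finite {p. \<forall>j<m0. tape (p + j) = ?c 0 j}"
        "\<exists>m1. finite {p. \<forall>j<m1. tape (p + j) = ?c 1 j}"
        unfolding attractor_def by blast+
      then obtain m0 m1 where fin: "finite {p. \<forall>j<m0. tape (p + j) = ?c 0 j}"
        "finite {p. \<forall>j<m1. tape (p + j) = ?c 1 j}"
        by blast
      have "{p. \<forall>j<m0 + m1. tape (p + j) = y j} \<subseteq> insert 0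
          (Suc ` ({p. \<forall>j<m0. tape (p + j) = ?c 0 j} \<union> {p. \<forall>j<m1. tape (p + j) = ?c 1 j}))"
      proof
        fix p
        assume "p \<in> {p. \<forall>j<m0 + m1. tape (p + j) = y j}"
        then have p: "tape (p + j) = y j" if "j < m0 + m1" for j using that by blast
        show "p \<in> insert 0 (Suc ` ({p. \<forall>j<m0. tape (p + j) = ?c 0 j} \<union>
            {p. \<forall>j<m1. tape (p + j) = ?c 1 j}))"
        proof (cases p)
          case (Suc q)
          have *: "tape (q + j) = ?c (tape q) j" if "j < m0 + m1" for j
            using p[of "j - 1"] that Suc by (cases j) simp_all
          have "tape q = 0 \<or> tape q = 1" using tape_le_1[of q] by linarith
          then have "(\<forall>j<m0 + m1. tape (q + j) = ?c 0 j) \<or> (\<forall>j<m0 + m1. tape (q + j) = ?c 1 j)"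
            using * by metis
          then have "q \<in> {p. \<forall>j<m0. tape (p + j) = ?c 0 j} \<union> {p. \<forall>j<m1. tape (p + j) = ?c 1 j}"
            by (elim disjE) simp_all
          then show ?thesis using Suc by blast
        qed simp
      qed
      then have "finite {p. \<forall>j<m0 + m1. tape (p + j) = y j}"
        by (rule finite_subset) (use fin in blast)
      with y show False unfolding attractor_def by blast
    qed
    moreover have "shift (?c c) = y" for c by (simp add: shift_def)
    ultimately show ?thesis by blast
  qed
  ultimately show ?thesis using step by (force simp: image_iff)
qed

subsection \<open>Measurability of the basin\<close>

definition near_attractor :: "nat \<Rightarrow> (nat \<Rightarrow> nat) \<Rightarrow> bool" where
  "near_attractor m x \<longleftrightarrow> (\<exists>y\<in>attractor. \<forall>j<m. x j = y j)"

text \<open>By compactness, an orbit that is infinitely often away from the attractor has a limit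
  point outside it. This expresses the basin by countably many open conditions.\<close>

lemma mem_basin_attractor_iff:
  assumes x: "x \<in> seqs 3"
  shows "x \<in> basin 3 step attractor \<longleftrightarrow> (\<forall>m. \<exists>N. \<forall>n\<ge>N. near_attractor m ((step ^^ n) x))"
    (is "_ \<longleftrightarrow> ?R")
proof
  assume R: ?R
  have "y \<in> attractor" if y: "y \<in> omega_limit 3 step x" for y
    unfolding attractor_def
  proof (rule CollectI, rule allI)
    fix m
    obtain N where N: "\<And>n. N \<le> n \<Longrightarrow> near_attractor m ((step ^^ n) x)"
      using R by blast
    have "infinite {n. \<forall>j<m. (step ^^ n) x j = y j}"
      using y by (simp add: omega_limit_iff)
    then obtain n where "N \<le> n" "\<forall>j<m. (step ^^ n) x j = y j"
      unfolding infinite_nat_iff_unbounded_le by blast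
    with N[of n] obtain y' where y': "y' \<in> attractor" "\<forall>j<m. y' j = y j"
      unfolding near_attractor_def by auto
    from y'(2) have "{p. \<forall>j<m. tape (p + j) = y j} = {p. \<forall>j<m. tape (p + j) = y' j}" by simp
    with y'(1) show "infinite {p. \<forall>j<m. tape (p + j) = y j}" unfolding attractor_def by simp
  qed
  with x show "x \<in> basin 3 step attractor" by (auto simp: basin_def)
next
  assume "x \<in> basin 3 step attractor"
  then have sub: "omega_limit 3 step x \<subseteq> attractor" by (simp add: basin_def)
  show ?R
  proof (rule ccontr)
    assume "\<not> ?R"
    then obtain m where m: "\<And>N. \<exists>n\<ge>N. \<not> near_attractor m ((step ^^ n) x)" by blast
    define I where "I = {n. \<not> near_attractor m ((step ^^ n) x)}"
    have "infinite I" using m unfolding I_def infinite_nat_iff_unbounded_le by blast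
    then obtain y where y: "y \<in> seqs 3" "\<And>i. infinite {n\<in>I. \<forall>j<i. (step ^^ n) x j = y j}"
      using accumulation_point[of I "\<lambda>n. (step ^^ n) x" 3] step_funpow_in_seqs[OF x(1)] by blast
    have "infinite {n. \<forall>j<i. (step ^^ n) x j = y j}" for i
      by (rule infinite_super[OF _ y(2)[of i]]) blast
    then have "y \<in> attractor" using sub y(1) by (auto simp: omega_limit_iff)
    moreover obtain n where "n \<in> I" "\<forall>j<m. (step ^^ n) x j = y j"
      using infinite_imp_nonempty[OF y(2)[of m]] by blast
    ultimately show False unfolding I_def near_attractor_def by blast
  qed
qed

text \<open>\<open>emeasure\<close> vanishes outside the sigma-algebra and \<open>\<mu>\<close> may
  be incomplete, so containing the full-measure set \<open>marked\<close> does not by itself give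
  the basin measure 1.\<close>

lemma sets_basin_attractor: "basin 3 step attractor \<in> sets (seq_borel 3)"
proof -
  have "openin (seq_topology 3) {x\<in>seqs 3. near_attractor m ((step ^^ n) x)}" for m n
    unfolding openin_seq_iff
  proof (intro conjI ballI)
    fix x
    assume "x \<in> {x\<in>seqs 3. near_attractor m ((step ^^ n) x)}"
    then obtain y where y: "y \<in> attractor" "\<forall>j<m. (step ^^ n) x j = y j"
      unfolding near_attractor_def by blast
    have "\<forall>j<m. (step ^^ n) z j = y j" if "\<forall>j<n + m. x j = z j" for z
      using y(2) step_funpow_cong[of n m x z] that by auto
    with y(1) have "near_attractor m ((step ^^ n) z)" if "\<forall>j<n + m. x j = z j" for z
      using that unfolding near_attractor_def by blast
    then show "\<exists>i. \<forall>z\<in>seqs 3. (\<forall>j<i. x j = z j) \<longrightarrow>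
        z \<in> {x\<in>seqs 3. near_attractor m ((step ^^ n) x)}"
      by blast
  qed blast
  then have *: "{x\<in>seqs 3. near_attractor m ((step ^^ n) x)} \<in> sets (seq_borel 3)" for m n
    by (rule open_in_seq_borel)
  have "basin 3 step attractor =
      {x\<in>space (seq_borel 3). \<forall>m. \<exists>N. \<forall>n. N \<le> n \<longrightarrow> near_attractor m ((step ^^ n) x)}"
    using mem_basin_attractor_iff by (auto simp: space_seq_borel basin_def)
  also have "\<dots> \<in> sets (seq_borel 3)"
    by (intro sets.sets_Collect sets.sets_Collect_const) (simp add: * space_seq_borel)
  finally show ?thesis .
qed

subsection \<open>Computability of the map\<close>

lemma effective_step:
  assumes "effective F" and "effective G"
  shows "effective (\<lambda>e. step (lnth (F e)) (G e))"
proof -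
  have fm: "effective (\<lambda>e. first_marker (lnth (F e)) (G e))"
    if "effective F" "effective G" for F G
  proof (rule effective_comp2[where f = "\<lambda>l. first_marker (lnth l)", OF _ that])
    have "effective (\<lambda>e. rec_nat 0
        (\<lambda>n r. if r = n \<and> \<not> lnth (e 0) n = 2 then Suc n else r) (e 1))"
      by (intro effective_rec eff)
    moreover have "rec_nat 0 (\<lambda>n r. if r = n \<and> \<not> x n = 2 then Suc n else r) n =
        first_marker x n" for x n
      by (induction n) simp_all
    ultimately show "effective (\<lambda>e. first_marker (lnth (e 0)) (e 1))" by simp
  qed
  show ?thesis
    unfolding step_def Let_def by (intro eff fm assms)
qed

lemma computable_map_step: "computable_map 3 step"
proof -
  have "effective (\<lambda>e. list_encode (map (\<lambda>i. step (lnth (e 1)) i) [0..<e 0]))"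
    by (intro effective_list_encode_map effective_step eff)
  then obtain p where p: "\<And>n l. computes p [n, l] (list_encode (map (step (lnth l)) [0..<n]))"
    using computable2_if_effective[of "\<lambda>n l. list_encode (map (step (lnth l)) [0..<n])"] by auto
  \<comment> \<open>The program sees the prefix padded with zeros; \<open>n + 1\<close> letters
    determine the first \<open>n\<close> letters of the image, so the padding is invisible.\<close>
  have "map (step (lnth (list_encode (map x [0..<Suc n])))) [0..<n] = map (step x) [0..<n]" for x n
    by (intro map_cong refl step_cong) (simp_all add: lnth_list_encode del: upt_Suc)
  with p have "computes p [n, list_encode (map x [0..<Suc n])] (list_encode (map (step x) [0..<n]))"
    for x n by metis
  moreover have "mono Suc" by (simp add: mono_def)
  moreover have "computable_fun Suc" by (intro computable_fun_if_effective eff)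
  ultimately show ?thesis
    unfolding computable_map_def using step_in_seqs by blast
qed

subsection \<open>The outer collection of the attractor\<close>

text \<open>\<open>ball_matches i p\<close> says that the tape from position \<open>p\<close> on lies in the \<open>i\<close>-th closed ideal
  ball. The bound on \<open>n\<close> is only there to make this decidable: it follows from the premise.\<close>

definition ball_matches :: "nat \<Rightarrow> nat \<Rightarrow> bool" where
  "ball_matches i p \<longleftrightarrow> (\<forall>n<Suc (psnd (psnd i)).
     \<not> Suc (pfst (psnd i)) * 2 ^ n < Suc (psnd (psnd i)) \<or> tape (p + n) = lnth (pfst i) n mod 3)"

lemma ball_center_eq: "ball_center 3 i = (\<lambda>n. lnth (pfst i) n mod 3)"
proof
  fix n
  have "lnth (pfst i) n = (if n < length (list_decode (pfst i)) then list_decode (pfst i) ! n else 0)"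
    using lnth_list_encode[of "list_decode (pfst i)" n] by simp
  then show "ball_center 3 i n = lnth (pfst i) n mod 3"
    by (simp add: ball_center_def ideal_point_def pfst_def)
qed

lemma ball_radius_less_iff:
  "ball_radius i < (1/2) ^ n \<longleftrightarrow> Suc (pfst (psnd i)) * 2 ^ n < Suc (psnd (psnd i))"
proof -
  have "ball_radius i < (1/2) ^ n \<longleftrightarrow>
      real (Suc (pfst (psnd i))) * 2 ^ n < real (Suc (psnd (psnd i)))"
    by (simp add: ball_radius_def pfst_def psnd_def case_prod_beta field_simps)
  also have "\<dots> \<longleftrightarrow> real (Suc (pfst (psnd i)) * 2 ^ n) < real (Suc (psnd (psnd i)))"
    by (simp only: of_nat_mult of_nat_power of_nat_numeral)
  finally show ?thesis by (simp only: of_nat_less_iff)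
qed

lemma mem_closed_ideal_ball_iff:
  assumes "y \<in> seqs 3"
  shows "y \<in> closed_ideal_ball 3 i \<longleftrightarrow> (\<forall>n<Suc (psnd (psnd i)).
     \<not> Suc (pfst (psnd i)) * 2 ^ n < Suc (psnd (psnd i)) \<or> y n = lnth (pfst i) n mod 3)"
proof -
  interpret Metric_space "seqs 3" seq_dist by (rule Metric_space_seqs)
  have "0 \<le> ball_radius i" by (simp add: ball_radius_def case_prod_beta)
  moreover have "ball_center 3 i \<in> seqs 3" by (simp add: ball_center_eq seqs_def)
  ultimately have "y \<in> closed_ideal_ball 3 i \<longleftrightarrow>
      (\<forall>n. Suc (pfst (psnd i)) * 2 ^ n < Suc (psnd (psnd i)) \<longrightarrow> lnth (pfst i) n mod 3 = y n)"
    using assms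
    by (simp add: closed_ideal_ball_def in_mcball seq_dist_le_iff ball_radius_less_iff
        ball_center_eq del: mult_Suc)
  \<comment> \<open>Since \<open>n < 2 ^ n\<close>, every position constrained by the radius lies
    below its denominator.\<close>
  moreover have "n < b" if "Suc a * 2 ^ n < b" for a b n :: nat
  proof -
    have "n < 2 ^ n" by (rule less_exp)
    also have "\<dots> \<le> Suc a * 2 ^ n" by simp
    finally show ?thesis using that by simp
  qed
  ultimately show ?thesis by metis
qed

text \<open>A ball constrains finitely many letters. Infinitely many matching positions accumulate
  at an attractor point in the ball; conversely, a long enough prefix of such a point recurs and
  matches.\<close>

lemma mem_outer_collection_attractor_iff:
  "i \<in> outer_collection 3 attractor \<longleftrightarrow> finite {p. ball_matches i p}"
proof
  assume i: "i \<in> outer_collection 3 attractor"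
  show "finite {p. ball_matches i p}"
  proof (rule ccontr)
    let ?I = "{p. ball_matches i p}"
    assume "infinite ?I"
    moreover have "(\<lambda>j. tape (p + j)) \<in> seqs 3" for p
      using tape_le_1 by (auto simp: seqs_def intro: le_less_trans[of _ 1])
    ultimately obtain y where y: "y \<in> seqs 3" "\<And>m. infinite {p\<in>?I. \<forall>j<m. tape (p + j) = y j}"
      using accumulation_point[of ?I "\<lambda>p j. tape (p + j)" 3] by blast
    have "infinite {p. \<forall>j<m. tape (p + j) = y j}" for m
      by (rule infinite_super[OF _ y(2)[of m]]) blast
    then have "y \<in> attractor" by (simp add: attractor_def)
    moreover obtain p where "ball_matches i p" "\<forall>j<Suc (psnd (psnd i)). tape (p + j) = y j"
      using infinite_imp_nonempty[OF y(2)[of "Suc (psnd (psnd i))"]] by blast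
    then have "y \<in> closed_ideal_ball 3 i"
      unfolding mem_closed_ideal_ball_iff[OF y(1)] ball_matches_def by metis
    ultimately show False using i by (auto simp: outer_collection_def)
  qed
next
  assume fin: "finite {p. ball_matches i p}"
  have False if y: "y \<in> attractor" "y \<in> closed_ideal_ball 3 i" for y
  proof -
    have "y \<in> seqs 3" using y(1) attractor_subset by blast
    note ball = y(2)[unfolded mem_closed_ideal_ball_iff[OF this]]
    have "infinite {p. \<forall>j<Suc (psnd (psnd i)). tape (p + j) = y j}"
      using y(1) unfolding attractor_def by blast
    moreover have "{p. \<forall>j<Suc (psnd (psnd i)). tape (p + j) = y j} \<subseteq> {p. ball_matches i p}"
      using ball unfolding ball_matches_def by force
    ultimately show False using fin finite_subset by blast
  qed
  then show "i \<in> outer_collection 3 attractor" by (auto simp: outer_collection_def)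
qed

lemma Sigma_set_outer_collection_attractor: "Sigma_set 2 (outer_collection 3 attractor)"
proof -
  have "infinite S \<longleftrightarrow> (\<forall>N. \<exists>p. N + p \<in> S)" for S :: "nat set"
    by (auto simp: infinite_nat_iff_unbounded_le le_iff_add)
  then have "finite {p. ball_matches i p} \<longleftrightarrow> (\<exists>N. \<forall>p. \<not> ball_matches i (N + p))" for i
    by (metis mem_Collect_eq)
  then have "outer_collection 3 attractor = {i. \<exists>N. \<forall>p. \<not> ball_matches i (N + p)}"
    by (intro set_eqI) (simp only: mem_outer_collection_attractor_iff mem_Collect_eq)
  moreover have "effective_pred (\<lambda>e. ball_matches (e 0) (e 1 + e 2))"
    unfolding ball_matches_def by (intro effective_all_less eff)
  ultimately show ?thesis
    using Sigma_set_2_if_effective[of "\<lambda>i N p. ball_matches i (N + p)"] by simp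
qed

text \<open>The index of the cylinder of \<open>marker_word m\<close>, as a ball of radius \<open>2\<^bsup>-(m+3)\<^esup>\<close>.\<close>

definition marker_index :: "nat \<Rightarrow> nat" where
  "marker_index m = prod_encode (list_encode (marker_word m), prod_encode (0, 2 ^ (m + 3) - 1))"

lemma effective_marker_index:
  assumes "effective F"
  shows "effective (\<lambda>e. marker_index (F e))"
proof (rule effective_comp1[OF _ assms])
  show "effective (\<lambda>e. marker_index (e 0))"
    unfolding marker_index_def marker_word_def by (intro effective_list_encode_map eff)
qed

lemma marker_index_mem_iff: "marker_index m \<in> outer_collection 3 attractor \<longleftrightarrow> \<not> all_halt m"
proof -
  have "Suc (2 ^ (m + 3) - 1) = 2 ^ (m + 3)" by simp
  moreover have "n < 2 ^ (m + 3)" if "n < m + 3" for n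
    using that less_exp[of "m + 3"] by linarith
  moreover have "marker_word m ! n mod 3 = marker_word m ! n" "length (marker_word m) = m + 3"
    if "n < m + 3" for n
    using that by (simp_all add: marker_word_def)
  ultimately have "ball_matches (marker_index m) p \<longleftrightarrow>
      (\<forall>n<m + 3. tape (p + n) = marker_word m ! n)" for p
    unfolding ball_matches_def marker_index_def pfst_encode psnd_encode lnth_list_encode
    by (auto simp del: power_Suc)
  then have "{p. ball_matches (marker_index m) p} =
      {p. \<forall>n<m + 3. tape (p + n) = marker_word m ! n}" by simp
  then show ?thesis
    unfolding mem_outer_collection_attractor_iff infinite_marker_word_iff[symmetric] by simp
qed

text \<open>A prefix yields at most one output, so its length minus 1 codes a candidate
  \<open>j\<close> and a time \<open>t\<close>; the program checks whether \<open>h j\<close> is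
  listed at time \<open>t\<close>. Reading past the prefix gives 0, a pause.\<close>

lemma enumerable_from_if_reducible:
  assumes "effective (\<lambda>e. h (e 0))" and red: "\<And>j. j \<in> S' \<longleftrightarrow> h j \<in> S"
  shows "enumerable_from S S'"
proof -
  define g where "g l = (if lnth l (psnd (llen l - 1)) = Suc (h (pfst (llen l - 1)))
      then Suc (pfst (llen l - 1)) else 0)" for l
  have "effective (\<lambda>e. g (e 0))"
    unfolding g_def by (intro eff effective_comp1[OF assms(1)])
  then obtain p where p: "\<And>l. computes p [l] (g l)"
    using computable_fun_if_effective unfolding computable_fun_def by blast
  have "S' = {j. \<exists>n. computes p [list_encode (map e [0..<n])] (Suc j)}" if e: "enumerates e S" for e
  proof (intro equalityI subsetI CollectI)
    fix j
    assume "j \<in> S'"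
    then have "Suc (h j) \<in> range e" using red e by (simp add: enumerates_def)
    then obtain t where t: "e t = Suc (h j)" by auto
    have "t < Suc (prod_encode (j, t))" using le_prod_encode_2[of t j] by simp
    then have "g (list_encode (map e [0..<Suc (prod_encode (j, t))])) = Suc j"
      using t by (simp add: g_def lnth_list_encode del: upt_Suc)
    with p show "\<exists>n. computes p [list_encode (map e [0..<n])] (Suc j)" by metis
  next
    fix j
    assume "j \<in> {j. \<exists>n. computes p [list_encode (map e [0..<n])] (Suc j)}"
    then obtain n where "g (list_encode (map e [0..<n])) = Suc j"
      using p computes_deterministic by blast
    then have "\<exists>t. e t = Suc (h j)"
      by (auto simp: g_def lnth_list_encode split: if_splits)
    then have "h j \<in> S" using e unfolding enumerates_def by (metis mem_Collect_eq rangeI)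
    then show "j \<in> S'" using red by blast
  qed
  then show ?thesis unfolding enumerable_from_def by blast
qed

lemma Pi_complete_attractor: "Pi_complete 3 2 attractor"
proof -
  have "enumerable_from (outer_collection 3 attractor) (outer_collection 3 K)"
    if K: "Pi_compact 3 2 K" for K
  proof -
    obtain c where c: "\<And>x. x \<in> outer_collection 3 K \<longleftrightarrow> \<not> all_halt (prod_encode (c, x))"
      using K Sigma_set_2_reduces_to_all_halt unfolding Pi_compact_def by blast
    show ?thesis
    proof (rule enumerable_from_if_reducible)
      show "effective (\<lambda>e. marker_index (prod_encode (c, e 0)))"
        by (intro effective_marker_index eff)
      show "x \<in> outer_collection 3 K \<longleftrightarrow>
          marker_index (prod_encode (c, x)) \<in> outer_collection 3 attractor" for x
        by (simp only: marker_index_mem_iff c)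
    qed
  qed
  then show ?thesis
    unfolding Pi_complete_def Pi_compact_def
    using compactin_attractor Sigma_set_outer_collection_attractor by blast
qed

subsection \<open>Attraction\<close>

lemma generic_in_marked: "marked \<subseteq> S \<Longrightarrow> generic_in (seq_topology 3) S"
  unfolding generic_in_def using openin_marked closure_of_marked
  by (intro exI[of _ "\<lambda>_. marked"]) blast

lemma marked_subset_seqs: "marked \<subseteq> seqs 3"
  by (auto simp: marked_def)

lemma marked_nonempty: "marked \<noteq> {}"
proof -
  have "(\<lambda>_. 2) \<in> marked" by (simp add: marked_def seqs_def)
  then show ?thesis by blast
qed

text \<open>The basin of a rival meets the open set \<open>marked\<close>, so the rival contains
  \<open>attractor\<close>; were it larger, \<open>attractor\<close> would violate its
  minimality.\<close>

lemma topological_attractor_iff: "topological_attractor 3 step A \<longleftrightarrow> A = attractor"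
proof
  assume A: "topological_attractor 3 step A"
  then have "basin 3 step A \<inter> marked \<noteq> {}"
    using generic_meets_open[OF _ openin_marked marked_nonempty]
    unfolding topological_attractor_def by blast
  then have "attractor \<subseteq> A" using mem_basin_iff_if_marked by blast
  moreover have "\<not> attractor \<subset> A"
  proof
    assume "attractor \<subset> A"
    then have "meager_in (seq_topology 3) (basin 3 step attractor)"
      using A closedin_attractor unfolding topological_attractor_def by blast
    then have "(topspace (seq_topology 3) - basin 3 step attractor) \<inter> marked \<noteq> {}"
      using generic_meets_open[OF _ openin_marked marked_nonempty] unfolding meager_in_def by blast
    then show False using mem_basin_iff_if_marked by blast
  qed
  ultimately show "A = attractor" by blast
next
  assume [simp]: "A = attractor"
  have "meager_in (seq_topology 3) (basin 3 step B)" if "B \<subset> attractor" for B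
  proof -
    have "marked \<subseteq> topspace (seq_topology 3) - basin 3 step B"
      using that mem_basin_iff_if_marked marked_subset_seqs unfolding topspace_seq_topology by blast
    then show ?thesis
      unfolding meager_in_def topspace_seq_topology
      by (auto simp: basin_def intro: generic_in_marked)
  qed
  moreover have "marked \<subseteq> basin 3 step attractor" using mem_basin_iff_if_marked by blast
  ultimately show "topological_attractor 3 step A"
    unfolding topological_attractor_def using closedin_attractor generic_in_marked by auto
qed

lemma metric_attractor_iff:
  assumes "shift_ergodic 3 \<mu>" and "full_support 3 \<mu>"
  shows "metric_attractor 3 step \<mu> A \<longleftrightarrow> A = attractor"
proof -
  have sets: "sets \<mu> = sets (seq_borel 3)" and one: "emeasure \<mu> (space \<mu>) = 1"
    using assms(1) unfolding shift_ergodic_def by blast+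
  have space: "space \<mu> = seqs 3"
    using sets_eq_imp_space_eq[OF sets] by (simp add: space_seq_borel)
  have marked: "emeasure \<mu> marked = 1" "marked \<in> sets \<mu>"
    using AE_visits_letter[OF assms, of 2] open_in_seq_borel[OF openin_marked] sets
    by (simp_all add: marked_def)
  have null: "emeasure \<mu> (basin 3 step B) = 0" if "\<not> attractor \<subseteq> B" for B
  proof -
    have "basin 3 step B \<subseteq> space \<mu> - marked"
      using that mem_basin_iff_if_marked by (auto simp: space basin_def)
    \<comment> \<open>Monotonicity asks for measurability of the larger set, which covers arbitrary
      \<open>B\<close>.\<close>
    then have "emeasure \<mu> (basin 3 step B) \<le> emeasure \<mu> (space \<mu> - marked)"
      by (rule emeasure_mono) (use marked in auto)
    also have "\<dots> = 1 - 1"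
      using emeasure_compl[of marked \<mu>] marked one by simp
    finally show ?thesis by simp
  qed
  have basin: "emeasure \<mu> (basin 3 step attractor) = 1"
  proof (rule antisym)
    show "emeasure \<mu> (basin 3 step attractor) \<le> 1"
      using emeasure_space[of \<mu> "basin 3 step attractor"] one by simp
    have "marked \<subseteq> basin 3 step attractor" using mem_basin_iff_if_marked by blast
    then have "emeasure \<mu> marked \<le> emeasure \<mu> (basin 3 step attractor)"
      by (rule emeasure_mono) (simp add: sets sets_basin_attractor)
    then show "1 \<le> emeasure \<mu> (basin 3 step attractor)" by (simp add: marked)
  qed
  show ?thesis
  proof
    assume A: "metric_attractor 3 step \<mu> A"
    then have "emeasure \<mu> (basin 3 step A) \<noteq> 0" by (simp add: metric_attractor_def one)
    then have "attractor \<subseteq> A" using null by blast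
    moreover have "\<not> attractor \<subset> A"
    proof
      assume "attractor \<subset> A"
      then have "\<not> 0 < emeasure \<mu> (basin 3 step attractor)"
        using A closedin_attractor unfolding metric_attractor_def by blast
      then show False by (simp add: basin)
    qed
    ultimately show "A = attractor" by blast
  next
    assume "A = attractor"
    moreover have "\<not> 0 < emeasure \<mu> (basin 3 step B)" if "B \<subset> attractor" for B
      using null[of B] that by auto
    ultimately show "metric_attractor 3 step \<mu> A"
      using basin one closedin_attractor unfolding metric_attractor_def by auto
  qed
qed

theorem theorem3:
  shows "\<exists>(k :: nat) (T :: (nat \<Rightarrow> nat) \<Rightarrow> nat \<Rightarrow> nat) (A :: (nat \<Rightarrow> nat) set).
    k \<ge> 2 \<and> computable_map k T \<and>
    A \<subseteq> seqs k \<and> T ` A = A \<and> Pi_complete k 2 A \<and>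
    topological_attractor k T A \<and> (\<forall>A'. topological_attractor k T A' \<longrightarrow> A' = A) \<and>
    (\<forall>\<mu>. shift_ergodic k \<mu> \<and> full_support k \<mu> \<longrightarrow>
       metric_attractor k T \<mu> A \<and> (\<forall>A'. metric_attractor k T \<mu> A' \<longrightarrow> A' = A))"
proof (intro exI conjI allI impI)
  show "2 \<le> (3 :: nat)" by simp
  show "computable_map 3 step" by (rule computable_map_step)
  show "attractor \<subseteq> seqs 3" by (rule attractor_subset)
  show "step ` attractor = attractor" by (rule image_step_attractor)
  show "Pi_complete 3 2 attractor" by (rule Pi_complete_attractor)
qed (simp_all add: topological_attractor_iff metric_attractor_iff)

end
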